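(* Let $X=\partial_x$ and $Y=x\,\partial_y$ be the Grushin vector fields on $\mathbb R^2$, with $Z=[X,Y]=\partial_y$, and let $H_i\in C^1(\mathbb R^m)$, $1\le i\le m$. Suppose that $u=(u_i)_{i=1}^m\in C^2(\mathbb R^2,\mathbb R^m)$ is a stable solution of the symmetric system $$\partial_{xx}u_i+x^2\partial_{yy}u_i=H_i(u_1,\dots,u_m)\quad\text{in }\mathbb R^2,\qquad1\le i\le m,$$ satisfying, for each $i$, $$ZYu_i\,Xu_i-ZXu_i\,Yu_i\le0 .$$ In addition, assume that for each $i$ one has $|\nabla_{\mathbb G}u_i|\ne0$ everywhere in $\mathbb R^2$ and that there is a constant $C$ with $$\int_{B_R}x^2|\nabla_{\mathbb G}u_i|^2\,dx\,dy\le CR^4\quad\text{for all }R>1,$$ where $B_R=\{(x,y)\in\mathbb R^2:\ x^4+y^2<R^4\}$. Then each $u_i$ depends only on the variable $x$.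
   Context: $\nabla_{\mathbb G}v:=(Xv)X+(Yv)Y$, $|\nabla_{\mathbb G}v|=\sqrt{(Xv)^2+(Yv)^2}=\sqrt{(\partial_xv)^2+x^2(\partial_yv)^2}$. The system is called symmetric if the matrix $(\partial_iH_j(u))_{i,j=1}^m$ is symmetric. A solution $u$ is called stable if $-\sum_{i,j=1}^m\int_{\mathbb R^2}\partial_iH_j(u)\zeta_i\zeta_j\le\sum_{i=1}^m\int_{\mathbb R^2}|\nabla_{\mathbb G}\zeta_i|^2$ for all $\zeta_i\in C_c^1(\mathbb R^2)$, $1\le i\le m$. *)

theory Defs
  imports "HOL-Analysis.Analysis"
begin

definition C1 :: "('a::real_normed_vector \<Rightarrow> 'b::real_normed_vector) \<Rightarrow> bool" where
  "C1 f \<longleftrightarrow> (\<exists>f'. (\<forall>x. (f has_derivative blinfun_apply (f' x)) (at x)) \<and> continuous_on UNIV f')"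

definition C2 :: "('a::real_normed_vector \<Rightarrow> 'b::real_normed_vector) \<Rightarrow> bool" where
  "C2 f \<longleftrightarrow> (\<exists>f'. (\<forall>x. (f has_derivative blinfun_apply (f' x)) (at x)) \<and> C1 f')"

definition C1c :: "('a::real_normed_vector \<Rightarrow> real) \<Rightarrow> bool" where
  "C1c f \<longleftrightarrow> C1 f \<and> compact (closure {x. f x \<noteq> 0})"

text \<open>A vector field on a normed space is a map from points to vectors; it acts on functions
  by differentiation in the direction it prescribes at each point.\<close>

definition along :: "('a::real_normed_vector \<Rightarrow> 'a) \<Rightarrow> ('a \<Rightarrow> 'b::real_normed_vector) \<Rightarrow> 'a \<Rightarrow> 'b" where
  "along V f p = vector_derivative (\<lambda>t. f (p + t *\<^sub>R V p)) (at 0)"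

definition lie_bracket :: "('a::real_normed_vector \<Rightarrow> 'a) \<Rightarrow> ('a \<Rightarrow> 'a) \<Rightarrow> 'a \<Rightarrow> 'a" where
  "lie_bracket V W p = along V W p - along W V p"

definition partial :: "'m::finite \<Rightarrow> (real ^ 'm \<Rightarrow> real) \<Rightarrow> real ^ 'm \<Rightarrow> real" where
  "partial i = along (\<lambda>_. axis i 1)"

definition dx :: "(real \<times> real \<Rightarrow> real) \<Rightarrow> real \<times> real \<Rightarrow> real" where
  "dx = along (\<lambda>_. (1, 0))"

definition dy :: "(real \<times> real \<Rightarrow> real) \<Rightarrow> real \<times> real \<Rightarrow> real" where
  "dy = along (\<lambda>_. (0, 1))"

definition fieldX :: "real \<times> real \<Rightarrow> real \<times> real" where
  "fieldX = (\<lambda>(x, y). (1, 0))"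

definition fieldY :: "real \<times> real \<Rightarrow> real \<times> real" where
  "fieldY = (\<lambda>(x, y). (0, x))"

definition fieldZ :: "real \<times> real \<Rightarrow> real \<times> real" where
  "fieldZ = lie_bracket fieldX fieldY"

abbreviation X :: "(real \<times> real \<Rightarrow> real) \<Rightarrow> real \<times> real \<Rightarrow> real" where "X \<equiv> along fieldX"
abbreviation Y :: "(real \<times> real \<Rightarrow> real) \<Rightarrow> real \<times> real \<Rightarrow> real" where "Y \<equiv> along fieldY"
abbreviation Z :: "(real \<times> real \<Rightarrow> real) \<Rightarrow> real \<times> real \<Rightarrow> real" where "Z \<equiv> along fieldZ"

lemma fieldZ_eq: "fieldZ = (\<lambda>_. (0, 1))"
proof
  fix p :: "real \<times> real"
  have "((\<lambda>t. fieldY (p + t *\<^sub>R fieldX p)) has_vector_derivative (0, 1)) (at 0)"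
    unfolding fieldX_def fieldY_def case_prod_beta
    by (auto intro!: derivative_eq_intros simp: has_vector_derivative_def)
  moreover have "((\<lambda>t. fieldX (p + t *\<^sub>R fieldY p)) has_vector_derivative 0) (at 0)"
    unfolding fieldX_def case_prod_beta by (rule has_vector_derivative_const)
  ultimately show "fieldZ p = (0, 1)"
    by (simp add: fieldZ_def lie_bracket_def along_def vector_derivative_at)
qed

lemma X_eq_dx: "X = dx"
  by (simp add: fun_eq_iff dx_def along_def fieldX_def)

lemma Z_eq_dy: "Z = dy"
  by (simp add: dy_def fieldZ_eq)

text \<open>The gradient is recorded by its coefficients in the frame (X, Y).  The length of
  a X + b Y is sqrt (a^2 + b^2), which is the product norm of this coefficient pair.\<close>

definition gradG :: "(real \<times> real \<Rightarrow> real) \<Rightarrow> real \<times> real \<Rightarrow> real \<times> real" where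
  "gradG v p = (X v p, Y v p)"

lemma norm_gradG: "norm (gradG v p) = sqrt ((X v p)\<^sup>2 + (Y v p)\<^sup>2)"
  by (simp add: gradG_def norm_prod_def)

definition solution ::
    "('m::finite \<Rightarrow> real ^ 'm \<Rightarrow> real) \<Rightarrow> (real \<times> real \<Rightarrow> real ^ 'm) \<Rightarrow> bool" where
  "solution H u \<longleftrightarrow>
    (\<forall>i x y. dx (dx (\<lambda>q. u q $ i)) (x, y) + x\<^sup>2 * dy (dy (\<lambda>q. u q $ i)) (x, y) = H i (u (x, y)))"

definition symmetric_system ::
    "('m::finite \<Rightarrow> real ^ 'm \<Rightarrow> real) \<Rightarrow> (real \<times> real \<Rightarrow> real ^ 'm) \<Rightarrow> bool" where
  "symmetric_system H u \<longleftrightarrow>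
    (\<forall>p. let A = (\<chi> i j. partial i (H j) (u p)) in transpose A = A)"

definition stable_solution ::
    "('m::finite \<Rightarrow> real ^ 'm \<Rightarrow> real) \<Rightarrow> (real \<times> real \<Rightarrow> real ^ 'm) \<Rightarrow> bool" where
  "stable_solution H u \<longleftrightarrow> solution H u \<and>
    (\<forall>\<zeta> :: 'm \<Rightarrow> real \<times> real \<Rightarrow> real. (\<forall>i. C1c (\<zeta> i)) \<longrightarrow>
      - (\<Sum>i\<in>UNIV. \<Sum>j\<in>UNIV. LINT p|lborel. partial i (H j) (u p) * \<zeta> i p * \<zeta> j p)
        \<le> (\<Sum>i\<in>UNIV. LINT p|lborel. (norm (gradG (\<zeta> i) p))\<^sup>2))"

definition BG :: "real \<Rightarrow> (real \<times> real) set" where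
  "BG R = {(x, y). x ^ 4 + y\<^sup>2 < R ^ 4}"

end

theory Submission
  imports Defs
begin

text \<open>Instead of \<open>|\<nabla>u\<^sub>i| \<phi>\<close>, whose use in the stability inequality leaves coupling terms of
  uncontrolled sign, we test with \<open>\<phi> Xu\<^sub>i\<close> and with \<open>\<phi> Yu\<^sub>i\<close> separately. Differentiating the system,
  \<open>\<Delta>Xu\<^sub>i = \<Sum>\<^sub>j \<partial>\<^sub>iH\<^sub>j Xu\<^sub>j - 2 ZYu\<^sub>i\<close> and \<open>\<Delta>Yu\<^sub>i = \<Sum>\<^sub>j \<partial>\<^sub>iH\<^sub>j Yu\<^sub>j + 2 ZXu\<^sub>i\<close> in the weak sense, so the two
  energies add up to
  \<open>2 \<Sum>\<^sub>i \<integral> \<phi>\<^sup>2 (ZYu\<^sub>i Xu\<^sub>i - ZXu\<^sub>i Yu\<^sub>i) + \<Sum>\<^sub>i \<integral> |\<nabla>u\<^sub>i|\<^sup>2 |\<nabla>\<phi>|\<^sup>2\<close>,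
  whose first term is nonpositive and whose second tends to 0 along logarithmic cutoffs. Each energy
  is nonnegative by stability, so \<open>(Xu\<^sub>i)\<close> and \<open>(Yu\<^sub>i)\<close> are null vectors of a nonnegative form and solve the
  linearized system without the commutator terms: \<open>ZYu\<^sub>i = x \<partial>\<^sub>y\<partial>\<^sub>yu\<^sub>i = 0\<close> and \<open>ZXu\<^sub>i = \<partial>\<^sub>y\<partial>\<^sub>xu\<^sub>i = 0\<close>. Hence
  \<open>\<partial>\<^sub>yu\<^sub>i\<close> is a constant, which the growth bound forces to be 0.\<close>

section \<open>Functions on the plane with continuous partial derivatives\<close>

text \<open>The partials are explicit arguments, so that the sum, product and chain rules compute
  them as terms which match the integrands of the weak equations directly. Differentiability with
  continuous coefficients is exactly the \<open>C1\<close> regularity of the test functions.\<close>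

definition has_partials ::
    "(real \<times> real \<Rightarrow> real) \<Rightarrow> (real \<times> real \<Rightarrow> real) \<Rightarrow> (real \<times> real \<Rightarrow> real) \<Rightarrow> bool" where
  "has_partials f a b \<longleftrightarrow>
    (\<forall>p. (f has_derivative (\<lambda>h. fst h * a p + snd h * b p)) (at p)) \<and>
    continuous_on UNIV a \<and> continuous_on UNIV b"

definition bdd_support :: "('a::real_normed_vector \<Rightarrow> real) \<Rightarrow> bool" where
  "bdd_support f \<longleftrightarrow> bounded {p. f p \<noteq> 0}"

lemma has_partialsD:
  assumes "has_partials f a b"
  shows "(f has_derivative (\<lambda>h. fst h * a p + snd h * b p)) (at p)"
    and "continuous_on UNIV a" "continuous_on UNIV b" "continuous_on UNIV f"
proof -
  show D: "(f has_derivative (\<lambda>h. fst h * a p + snd h * b p)) (at p)" for p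
    using assms unfolding has_partials_def by blast
  show "continuous_on UNIV a" "continuous_on UNIV b"
    using assms unfolding has_partials_def by blast+
  show "continuous_on UNIV f"
    using D by (rule has_derivative_continuous_on)
qed

text \<open>Chain rule along the line \<open>t \<mapsto> p + t *\<^sub>R V p\<close>. It replaces
  the choice hidden in \<open>vector_derivative\<close> by the value of an actual
  derivative.\<close>

lemma along_has_derivative:
  assumes "(f has_derivative D) (at p)"
  shows "along V f p = D (V p)"
proof -
  have f: "(f has_derivative D) (at (p + 0 *\<^sub>R V p))" using assms by simp
  have g: "((\<lambda>t. p + t *\<^sub>R V p) has_derivative (\<lambda>t. t *\<^sub>R V p)) (at 0)"
    by (auto intro!: derivative_eq_intros)
  have "((\<lambda>t. f (p + t *\<^sub>R V p)) has_derivative (\<lambda>t. D (t *\<^sub>R V p))) (at 0)"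
    using has_derivative_compose[OF g f] by simp
  also have "(\<lambda>t. D (t *\<^sub>R V p)) = (\<lambda>t. t *\<^sub>R D (V p))"
    using has_derivative_linear[OF assms] by (simp add: linear_scale)
  finally show ?thesis
    unfolding along_def by (simp add: has_vector_derivative_def vector_derivative_at)
qed

lemma along_has_partials:
  assumes "has_partials f a b"
  shows "X f = a" "Y f = (\<lambda>p. fst p * b p)" "Z f = b" "dx f = a" "dy f = b"
  using along_has_derivative[OF has_partialsD(1)[OF assms]]
  by (auto simp: fun_eq_iff fieldX_def fieldY_def fieldZ_eq case_prod_beta dx_def dy_def)

lemma has_partials_imp_C1:
  assumes "has_partials f a b"
  shows "C1 f"
proof -
  define D where "D p = a p *\<^sub>R Blinfun fst + b p *\<^sub>R (Blinfun snd :: (real \<times> real) \<Rightarrow>\<^sub>L real)" for p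
  have "blinfun_apply (D p) = (\<lambda>h. fst h * a p + snd h * b p)" for p
    by (auto simp: D_def fun_eq_iff blinfun.bilinear_simps bounded_linear_Blinfun_apply
        bounded_linear_fst bounded_linear_snd)
  moreover have "continuous_on UNIV D"
    unfolding D_def using has_partialsD[OF assms] by (intro continuous_intros)
  ultimately show ?thesis
    unfolding C1_def using has_partialsD(1)[OF assms] by (intro exI[of _ D]) auto
qed

text \<open>The entry point of concrete test functions into the stability inequality: a bounded
  support in the plane has compact closure.\<close>

lemma C1c_has_partials:
  assumes "has_partials f a b" "bdd_support f"
  shows "C1c f"
  using assms has_partials_imp_C1[OF assms(1)]
  by (simp add: C1c_def bdd_support_def bounded_closure compact_eq_bounded_closed)

lemma has_partials_const: "has_partials (\<lambda>_. c) (\<lambda>_. 0) (\<lambda>_. 0)"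
  by (simp add: has_partials_def)

lemma has_partials_fst: "has_partials fst (\<lambda>_. 1) (\<lambda>_. 0)"
  by (auto simp: has_partials_def intro!: derivative_eq_intros)

lemma has_partials_add:
  assumes "has_partials f a b" "has_partials g c d"
  shows "has_partials (\<lambda>p. f p + g p) (\<lambda>p. a p + c p) (\<lambda>p. b p + d p)"
proof -
  note F = has_partialsD[OF assms(1)] and G = has_partialsD[OF assms(2)]
  show ?thesis
    unfolding has_partials_def
  proof (intro conjI allI)
    fix p
    show "((\<lambda>p. f p + g p) has_derivative (\<lambda>h. fst h * (a p + c p) + snd h * (b p + d p))) (at p)"
      by (rule has_derivative_eq_rhs[OF has_derivative_add[OF F(1) G(1)]]) (simp add: fun_eq_iff algebra_simps)
  qed (intro continuous_on_add continuous_on_mult F G)+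
qed

lemma has_partials_mult:
  assumes "has_partials f a b" "has_partials g c d"
  shows "has_partials (\<lambda>p. f p * g p) (\<lambda>p. a p * g p + f p * c p) (\<lambda>p. b p * g p + f p * d p)"
proof -
  note F = has_partialsD[OF assms(1)] and G = has_partialsD[OF assms(2)]
  show ?thesis
    unfolding has_partials_def
  proof (intro conjI allI)
    fix p
    show "((\<lambda>p. f p * g p) has_derivative (\<lambda>h. fst h * (a p * g p + f p * c p) + snd h * (b p * g p + f p * d p))) (at p)"
      by (rule has_derivative_eq_rhs[OF has_derivative_mult[OF F(1) G(1)]]) (simp add: fun_eq_iff algebra_simps)
  qed (intro continuous_on_add continuous_on_mult F G)+
qed

lemma has_partials_compose:
  assumes f: "has_partials f a b"
    and g: "\<And>p. (g has_real_derivative g' (f p)) (at (f p))"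
    and g': "continuous_on (range f) g'"
  shows "has_partials (\<lambda>p. g (f p)) (\<lambda>p. g' (f p) * a p) (\<lambda>p. g' (f p) * b p)"
proof -
  have "continuous_on UNIV (\<lambda>p. g' (f p))"
    by (rule continuous_on_compose2[OF g']) (use has_partialsD[OF f] in auto)
  moreover have "((\<lambda>p. g (f p)) has_derivative (\<lambda>h. fst h * (g' (f p) * a p) + snd h * (g' (f p) * b p))) (at p)" for p
  proof -
    have "(g has_derivative (*) (g' (f p))) (at (f p))"
      using g unfolding has_field_derivative_def by simp
    from has_derivative_compose[OF has_partialsD(1)[OF f] this]
    show ?thesis by (simp add: algebra_simps)
  qed
  ultimately show ?thesis
    unfolding has_partials_def
    by (intro conjI allI continuous_on_mult has_partialsD(2,3)[OF f])
qed

section \<open>Functions of bounded support\<close>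

lemma bdd_support_subset: "bdd_support f \<Longrightarrow> (\<And>p. f p = 0 \<Longrightarrow> g p = 0) \<Longrightarrow> bdd_support g"
  unfolding bdd_support_def by (rule bounded_subset) auto

lemma bdd_supportE:
  assumes "bdd_support f"
  obtains r where "r > 0" "\<And>p. norm p > r \<Longrightarrow> f p = 0"
proof -
  obtain r where "r > 0" "\<forall>p\<in>{p. f p \<noteq> 0}. norm p \<le> r"
    using assms unfolding bdd_support_def bounded_pos by blast
  then show ?thesis by (intro that[of r]) force+
qed

lemma bdd_supportI: "(\<And>p. norm p > r \<Longrightarrow> f p = 0) \<Longrightarrow> bdd_support f"
  unfolding bdd_support_def bounded_iff by (intro exI[of _ r]) force

text \<open>Outside a large ball \<open>f\<close> vanishes on an open set, so its derivative there
  is 0 by uniqueness, and both coefficients vanish.\<close>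

lemma bdd_support_partials:
  assumes f: "has_partials f a b" and "bdd_support f"
  shows "bdd_support a" "bdd_support b"
proof -
  obtain r where r: "r > 0" "\<And>p. norm p > r \<Longrightarrow> f p = 0" using bdd_supportE[OF assms(2)] by blast
  have D: "fst h * a p + snd h * b p = 0" if "norm p > r" for p h
  proof -
    have "open {q :: real \<times> real. norm q > r}"
      by (intro open_Collect_less continuous_intros)
    then have "(f has_derivative (\<lambda>_. 0)) (at p)"
      using that r(2)
      by (intro has_derivative_transform_within_open[OF has_derivative_const[of 0]]) auto
    from has_derivative_unique[OF has_partialsD(1)[OF f] this] show ?thesis
      by (rule fun_cong)
  qed
  show "bdd_support a" using D[where h = "(1,0)"] by (intro bdd_supportI[of r]) auto
  show "bdd_support b" using D[where h = "(0,1)"] by (intro bdd_supportI[of r]) auto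
qed

section \<open>Integration by parts\<close>

lemma integrable_bdd_support:
  fixes f :: "'a::euclidean_space \<Rightarrow> real"
  assumes "continuous_on UNIV f" "bdd_support f"
  shows "integrable lborel f"
proof -
  obtain r where r: "\<And>p. norm p > r \<Longrightarrow> f p = 0" using bdd_supportE[OF assms(2)] by blast
  have "integrable lborel (\<lambda>x. indicator (cball 0 r) x *\<^sub>R f x)"
    by (rule borel_integrable_compact) (auto intro: continuous_on_subset[OF assms(1)])
  also have "(\<lambda>x. indicator (cball 0 r) x *\<^sub>R f x) = f"
    using r by (auto simp: fun_eq_iff indicator_def)
  finally show ?thesis .
qed

lemma integral_lborel_translate:
  fixes f :: "'a::euclidean_space \<Rightarrow> real"
  assumes "f \<in> borel_measurable borel"
  shows "(LINT p|lborel. f (p + e)) = (LINT p|lborel. f p)"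
proof -
  have "(LINT p|lborel. f p) = (LINT p|distr lborel borel ((+) e). f p)"
    using lborel_distr_plus[of e] by simp
  also have "\<dots> = (LINT p|lborel. f (e + p))"
    by (rule integral_distr) (use assms in auto)
  finally show ?thesis by (simp add: add.commute)
qed

text \<open>Dominated convergence: the quotients converge pointwise to the directional derivative,
  and on the support of \<open>k\<close> the mean value inequality bounds them by a constant. Here
  \<open>k\<close> is merely integrable, so that truncations by indicators are admissible.\<close>

lemma difference_quotient_tendsto_integral:
  assumes f: "has_partials f a b"
    and k: "integrable lborel k" "bdd_support k"
    and s: "\<And>n. s n \<noteq> 0" "\<And>n. \<bar>s n\<bar> \<le> (1::real)" "s \<longlonglongrightarrow> 0"
    and e: "norm e = 1"
  shows "(\<lambda>n. LINT p|lborel. (f (p + s n *\<^sub>R e) - f p) / s n * k p)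
           \<longlonglongrightarrow> (LINT p|lborel. (fst e * a p + snd e * b p) * k p)"
proof -
  obtain r where r: "r > 0" "\<And>p. norm p > r \<Longrightarrow> k p = 0" using bdd_supportE[OF k(2)] by blast
  have ca: "continuous_on UNIV a" "continuous_on UNIV b" "continuous_on UNIV f"
    using has_partialsD[OF f] by auto
  \<comment> \<open>The radius is \<open>r + 1\<close> because a step \<open>s n *\<^sub>R e\<close>
    has length at most 1 and may leave the ball of radius \<open>r\<close> that carries
    \<open>k\<close>.\<close>
  have "compact ((\<lambda>p. \<bar>a p\<bar> + \<bar>b p\<bar>) ` cball 0 (r + 1))"
    by (intro compact_continuous_image continuous_intros continuous_on_subset[OF ca(1)]
        continuous_on_subset[OF ca(2)]) auto
  then have "bounded ((\<lambda>p. \<bar>a p\<bar> + \<bar>b p\<bar>) ` cball 0 (r + 1))" by (rule compact_imp_bounded)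
  then obtain M where "\<forall>p\<in>cball 0 (r + 1). norm (\<bar>a p\<bar> + \<bar>b p\<bar>) \<le> M"
    unfolding bounded_iff by auto
  then have M: "\<bar>a p\<bar> + \<bar>b p\<bar> \<le> M" if "p \<in> cball 0 (r + 1)" for p
    using that by fastforce
  have lip: "\<bar>(f (p + s n *\<^sub>R e) - f p) / s n\<bar> \<le> M" if "norm p \<le> r" for p n
  proof -
    have "norm (f (p + s n *\<^sub>R e) - f p) \<le> M * norm (p + s n *\<^sub>R e - p)"
    proof (rule differentiable_bound[where S = "cball 0 (r + 1)" and f' = "\<lambda>p h. fst h * a p + snd h * b p"])
      fix q :: "real \<times> real" assume q: "q \<in> cball 0 (r + 1)"
      show "(f has_derivative (\<lambda>h. fst h * a q + snd h * b q)) (at q within cball 0 (r + 1))"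
        using has_partialsD(1)[OF f] by (rule has_derivative_at_withinI)
      show "onorm (\<lambda>h. fst h * a q + snd h * b q) \<le> M"
      proof (rule onorm_le)
        fix h :: "real \<times> real"
        have "\<bar>fst h * a q + snd h * b q\<bar> \<le> \<bar>fst h\<bar> * \<bar>a q\<bar> + \<bar>snd h\<bar> * \<bar>b q\<bar>"
          by (simp add: abs_mult[symmetric])
        also have "\<dots> \<le> norm h * \<bar>a q\<bar> + norm h * \<bar>b q\<bar>"
          using norm_fst_le[of "fst h" "snd h"] norm_snd_le[of "snd h" "fst h"]
          by (intro add_mono mult_right_mono) auto
        also have "\<dots> = (\<bar>a q\<bar> + \<bar>b q\<bar>) * norm h" by (simp add: algebra_simps)
        also have "\<dots> \<le> M * norm h" using M[OF q] by (intro mult_right_mono) auto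
        finally show "norm (fst h * a q + snd h * b q) \<le> M * norm h" by simp
      qed
    next
      show "p + s n *\<^sub>R e \<in> cball 0 (r + 1)"
        using norm_triangle_ineq[of p "s n *\<^sub>R e"] that s(2)[of n] e by simp
    qed (use that in auto)
    then show ?thesis using s(1)[of n] e by (simp add: abs_divide divide_simps)
  qed
  show ?thesis
  proof (rule integral_dominated_convergence[where w = "\<lambda>p. M * \<bar>k p\<bar>"])
    show "integrable lborel (\<lambda>p. M * \<bar>k p\<bar>)" using k(1) by (intro integrable_mult_right integrable_abs)
    have mf: "f \<in> borel_measurable borel" "a \<in> borel_measurable borel" "b \<in> borel_measurable borel"
      using ca by (auto intro: borel_measurable_continuous_onI)
    have mk: "k \<in> borel_measurable borel" using k(1) by simp
    have mc: "(\<lambda>p. f (p + s n *\<^sub>R e)) \<in> borel_measurable borel" for n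
      by (rule borel_measurable_continuous_onI)
        (auto intro!: continuous_on_compose2[OF ca(3)] continuous_intros)
    show "(\<lambda>p. (fst e * a p + snd e * b p) * k p) \<in> borel_measurable lborel"
      using mk mf by simp
    show "(\<lambda>p. (f (p + s n *\<^sub>R e) - f p) / s n * k p) \<in> borel_measurable lborel" for n
      using mk mf mc by simp
    show "AE p in lborel. norm ((f (p + s n *\<^sub>R e) - f p) / s n * k p) \<le> M * \<bar>k p\<bar>" for n
    proof (rule AE_I2)
      fix p show "norm ((f (p + s n *\<^sub>R e) - f p) / s n * k p) \<le> M * \<bar>k p\<bar>"
        unfolding real_norm_def abs_mult using mult_right_mono[OF lip[of p n] abs_ge_zero[of "k p"]] r(2)[of p]
        by (cases "norm p \<le> r") auto
    qed
    show "AE p in lborel. (\<lambda>n. (f (p + s n *\<^sub>R e) - f p) / s n * k p) \<longlonglongrightarrow> (fst e * a p + snd e * b p) * k p"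
    proof (rule AE_I2)
      fix p
      have f0: "(f has_derivative (\<lambda>h. fst h * a p + snd h * b p)) (at (p + 0 *\<^sub>R e))"
        using has_partialsD(1)[OF f, of p] by simp
      have g: "((\<lambda>t. p + t *\<^sub>R e) has_derivative (\<lambda>t. t *\<^sub>R e)) (at 0)"
        by (auto intro!: derivative_eq_intros)
      have "((\<lambda>t. f (p + t *\<^sub>R e)) has_real_derivative (fst e * a p + snd e * b p)) (at 0)"
        unfolding has_field_derivative_def
        by (rule has_derivative_eq_rhs[OF has_derivative_compose[OF g f0]])
          (simp add: fun_eq_iff algebra_simps)
      then have "((\<lambda>h. (f (p + h *\<^sub>R e) - f p) / h) \<longlongrightarrow> fst e * a p + snd e * b p) (at 0)"
        unfolding DERIV_def by simp
      moreover have "filterlim s (at 0) sequentially"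
        using s by (auto simp: filterlim_at)
      ultimately have "(\<lambda>n. (f (p + s n *\<^sub>R e) - f p) / s n) \<longlonglongrightarrow> fst e * a p + snd e * b p"
        by (rule filterlim_compose)
      then show "(\<lambda>n. (f (p + s n *\<^sub>R e) - f p) / s n * k p) \<longlonglongrightarrow> (fst e * a p + snd e * b p) * k p"
        by (intro tendsto_intros)
    qed
  qed
qed

section \<open>Translation and truncation of functions\<close>

lemma continuous_translate:
  fixes f :: "'a::real_normed_vector \<Rightarrow> real"
  assumes "continuous_on UNIV f"
  shows "continuous_on UNIV (\<lambda>p. f (p + e))"
  by (rule continuous_on_compose2[OF assms]) (auto intro!: continuous_intros)

lemma bdd_support_translate:
  assumes "bdd_support f"
  shows "bdd_support (\<lambda>p. f (p + e))"
proof -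
  obtain r where r: "\<And>p. norm p > r \<Longrightarrow> f p = 0" using bdd_supportE[OF assms] by blast
  show ?thesis
  proof (rule bdd_supportI[of "r + norm e"])
    fix p :: 'a assume "norm p > r + norm e"
    then have "norm (p + e) > r" using norm_triangle_ineq4[of "p + e" e] by simp
    then show "f (p + e) = 0" by (rule r)
  qed
qed

lemma has_partials_translate:
  assumes "has_partials f a b"
  shows "has_partials (\<lambda>p. f (p + e)) (\<lambda>p. a (p + e)) (\<lambda>p. b (p + e))"
  unfolding has_partials_def
proof (intro conjI allI continuous_translate has_partialsD(2,3)[OF assms])
  fix p
  have g: "((\<lambda>p. p + e) has_derivative (\<lambda>h. h)) (at p)"
    by (auto intro!: derivative_eq_intros)
  show "((\<lambda>p. f (p + e)) has_derivative (\<lambda>h. fst h * a (p + e) + snd h * b (p + e))) (at p)"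
    by (rule has_derivative_compose[OF g has_partialsD(1)[OF assms]])
qed

lemma has_partials_cmult:
  assumes "has_partials f a b"
  shows "has_partials (\<lambda>p. c * f p) (\<lambda>p. c * a p) (\<lambda>p. c * b p)"
  using has_partials_mult[OF has_partials_const[of c] assms] by simp

lemma bdd_support_add: "bdd_support f \<Longrightarrow> bdd_support g \<Longrightarrow> bdd_support (\<lambda>p. f p + g p)"
  unfolding bdd_support_def
  by (rule bounded_subset[where T = "{p. f p \<noteq> 0} \<union> {p. g p \<noteq> 0}"]) auto

lemma bdd_support_mult_indicator:
  assumes "bdd_support f"
  obtains r where "\<And>p r'. r' \<ge> r \<Longrightarrow> f p * indicator (cball 0 r') p = f p"
proof -
  obtain r where r: "\<And>p. norm p > r \<Longrightarrow> f p = 0" using bdd_supportE[OF assms] by blast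
  then show ?thesis by (intro that[of r]) (auto simp: indicator_def)
qed

lemma integrable_mult_indicator_cball:
  fixes f :: "'a::euclidean_space \<Rightarrow> real"
  assumes "continuous_on UNIV f"
  shows "integrable lborel (\<lambda>p. f p * indicator (cball 0 r) p)"
    and "bdd_support (\<lambda>p. f p * indicator (cball 0 r) p)"
proof -
  have "integrable lborel (\<lambda>x. indicator (cball 0 r) x *\<^sub>R f x)"
    by (rule borel_integrable_compact) (auto intro: continuous_on_subset[OF assms])
  then show "integrable lborel (\<lambda>p. f p * indicator (cball 0 r) p)"
    by (simp add: mult.commute)
  show "bdd_support (\<lambda>p. f p * indicator (cball 0 r) p)"
    by (rule bdd_supportI[of r]) (auto simp: indicator_def)
qed

text \<open>The bounded support now sits on \<open>g\<close>. Truncating \<open>k\<close> to a ball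
  that contains the support of \<open>g\<close> with a margin of 1 changes neither the quotients nor
  the limit, and reduces this to the case where \<open>k\<close> has bounded support.\<close>

lemma difference_quotient_tendsto_integral':
  assumes g: "has_partials g a b" "bdd_support g"
    and k: "continuous_on UNIV k"
    and s: "\<And>n. s n \<noteq> 0" "\<And>n. \<bar>s n\<bar> \<le> (1::real)" "s \<longlonglongrightarrow> 0"
    and e: "norm e = 1"
  shows "(\<lambda>n. LINT p|lborel. (g (p + s n *\<^sub>R e) - g p) / s n * k p)
           \<longlonglongrightarrow> (LINT p|lborel. (fst e * a p + snd e * b p) * k p)"
proof -
  have "bdd_support (\<lambda>p. (fst e * a p + snd e * b p) * k p)"
    by (rule bdd_support_subset[OF bdd_support_add[where f = "\<lambda>p. fst e * a p" and g = "\<lambda>p. snd e * b p"]])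
      (auto intro: bdd_support_subset[OF bdd_support_partials(1)[OF g]]
        bdd_support_subset[OF bdd_support_partials(2)[OF g]])
  then obtain r1 where r1:
    "\<And>p r'. r' \<ge> r1 \<Longrightarrow> (fst e * a p + snd e * b p) * k p * indicator (cball 0 r') p = (fst e * a p + snd e * b p) * k p"
    by (rule bdd_support_mult_indicator) blast
  obtain r0 where r0: "\<And>p. norm p > r0 \<Longrightarrow> g p = 0" using bdd_supportE[OF g(2)] by blast
  define r where "r = max (r0 + 1) r1"
  have *: "(g (p + s n *\<^sub>R e) - g p) / s n * (k p * indicator (cball 0 r) p)
       = (g (p + s n *\<^sub>R e) - g p) / s n * k p" for n p
  proof (cases "norm p \<le> r")
    case False
    then have "norm p > r0 + 1" by (simp add: r_def)
    moreover from this have "norm (p + s n *\<^sub>R e) > r0"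
      using norm_triangle_ineq4[of "p + s n *\<^sub>R e" "s n *\<^sub>R e"] s(2)[of n] e by simp
    ultimately show ?thesis by (simp add: r0)
  qed (simp add: indicator_def)
  have **: "(fst e * a p + snd e * b p) * (k p * indicator (cball 0 r) p) = (fst e * a p + snd e * b p) * k p" for p
    using r1[of r p] by (simp add: r_def mult.assoc)
  show ?thesis
    using difference_quotient_tendsto_integral[OF g(1) integrable_mult_indicator_cball[OF k, of r] s e]
    unfolding * ** .
qed

text \<open>Step sizes of both signs: the sign changes when a difference quotient is moved from one
  factor of an integral to the other.\<close>

lemma inverse_Suc_seq:
  "inverse (real (Suc n)) \<noteq> 0" "\<bar>inverse (real (Suc n))\<bar> \<le> 1"
  "(\<lambda>n. inverse (real (Suc n))) \<longlonglongrightarrow> 0"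
  "- inverse (real (Suc n)) \<noteq> 0" "\<bar>- inverse (real (Suc n))\<bar> \<le> 1"
  "(\<lambda>n. - inverse (real (Suc n))) \<longlonglongrightarrow> 0"
  using LIMSEQ_inverse_real_of_nat tendsto_minus[OF LIMSEQ_inverse_real_of_nat]
  by (auto simp: field_simps)

text \<open>By translation invariance of Lebesgue measure the difference quotients of
  \<open>f\<close> all have integral 0, hence so does their limit, the directional
  derivative.\<close>

lemma integral_partial_eq_0:
  assumes f: "has_partials f a b" "bdd_support f"
  shows "(LINT p|lborel. a p) = 0" "(LINT p|lborel. b p) = 0"
proof -
  have *: "(LINT p|lborel. fst e * a p + snd e * b p) = 0" if e: "norm e = 1" for e
  proof -
    define s where "s n = inverse (real (Suc n))" for n
    have cf: "continuous_on UNIV f" by (rule has_partialsD(4)[OF f(1)])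
    have zero: "(LINT p|lborel. (f (p + s n *\<^sub>R e) - f p) / s n * 1) = 0" for n
    proof -
      have "(LINT p|lborel. f (p + s n *\<^sub>R e) - f p) = 0"
        using integral_lborel_translate[of f "s n *\<^sub>R e"] borel_measurable_continuous_onI[OF cf]
        by (subst Bochner_Integration.integral_diff)
          (auto intro!: integrable_bdd_support continuous_translate bdd_support_translate f cf)
      then show ?thesis by simp
    qed
    have "(\<lambda>n. LINT p|lborel. (f (p + s n *\<^sub>R e) - f p) / s n * 1)
           \<longlonglongrightarrow> (LINT p|lborel. (fst e * a p + snd e * b p) * 1)"
      unfolding s_def by (rule difference_quotient_tendsto_integral'[OF f continuous_on_const inverse_Suc_seq(1-3) e])
    then show ?thesis unfolding zero by (simp add: LIMSEQ_const_iff)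
  qed
  show "(LINT p|lborel. a p) = 0" "(LINT p|lborel. b p) = 0"
    using *[of "(1,0)"] *[of "(0,1)"] by simp_all
qed

text \<open>The product \<open>f * g\<close> has bounded support, so the integrals of its partials
  vanish; the product rule splits them.\<close>

lemma integration_by_parts:
  assumes f: "has_partials f a b" and g: "has_partials g c d" "bdd_support g"
  shows "(LINT p|lborel. a p * g p) = - (LINT p|lborel. f p * c p)"
    and "(LINT p|lborel. b p * g p) = - (LINT p|lborel. f p * d p)"
proof -
  note F = has_partialsD[OF f] and G = has_partialsD[OF g(1)]
  have s: "bdd_support (\<lambda>p. f p * g p)" by (rule bdd_support_subset[OF g(2)]) simp
  note z = integral_partial_eq_0[OF has_partials_mult[OF f g(1)] s]
  have i: "integrable lborel (\<lambda>p. u p * g p)" if "continuous_on UNIV u" for u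
    by (intro integrable_bdd_support continuous_on_mult that G bdd_support_subset[OF g(2)]) simp
  have j: "integrable lborel (\<lambda>p. f p * c p)" "integrable lborel (\<lambda>p. f p * d p)"
    by (auto intro!: integrable_bdd_support continuous_on_mult F G
      intro: bdd_support_subset[OF bdd_support_partials(1)[OF g]]
        bdd_support_subset[OF bdd_support_partials(2)[OF g]])
  show "(LINT p|lborel. a p * g p) = - (LINT p|lborel. f p * c p)"
    using z(1) i[OF F(2)] j(1) by simp
  show "(LINT p|lborel. b p * g p) = - (LINT p|lborel. f p * d p)"
    using z(2) i[OF F(3)] j(2) by simp
qed

text \<open>If second derivatives existed, two integrations by parts would give this. For C1
  functions the derivative \<open>d\<close> of \<open>g\<close> is first replaced by a difference
  quotient in the direction \<open>e\<close>; integration by parts in the first variable and a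
  translation then move the quotient onto \<open>f\<close>, and the step size tends to 0. This is
  what makes third derivatives of the solution dispensable.\<close>

lemma integral_partials_commute:
  assumes f: "has_partials f a b" and g: "has_partials g c d" "bdd_support g"
  shows "(LINT p|lborel. a p * d p) = (LINT p|lborel. b p * c p)"
proof -
  define s where "s n = inverse (real (Suc n))" for n
  define e :: "real \<times> real" where "e = (0, 1)"
  have e: "norm e = 1" by (simp add: e_def)
  note F = has_partialsD[OF f] and G = has_partialsD[OF g(1)]
  have bc: "bdd_support c" by (rule bdd_support_partials[OF g])
  have eq: "(LINT p|lborel. (g (p + s n *\<^sub>R e) - g p) / s n * a p)
      = (LINT p|lborel. (f (p + (- s n) *\<^sub>R e) - f p) / (- s n) * c p)" for n
  proof -
    have s0: "s n \<noteq> 0" by (simp add: s_def)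
    \<comment> \<open>The quotient is written as a multiple of a sum, the shape for which the
      closure rules produce its partials.\<close>
    have D: "has_partials (\<lambda>p. (1 / s n) * (g (p + s n *\<^sub>R e) + (- 1) * g p))
        (\<lambda>p. (1 / s n) * (c (p + s n *\<^sub>R e) + (- 1) * c p)) (\<lambda>p. (1 / s n) * (d (p + s n *\<^sub>R e) + (- 1) * d p))"
      by (intro has_partials_cmult has_partials_add has_partials_translate g)
    have Ds: "bdd_support (\<lambda>p. (1 / s n) * (g (p + s n *\<^sub>R e) + (- 1) * g p))"
      by (rule bdd_support_subset[OF bdd_support_add[OF bdd_support_translate[OF g(2), of "s n *\<^sub>R e"] bdd_support_subset[OF g(2), of "\<lambda>p. - 1 * g p"]]])
        auto
    \<comment> \<open>A change of variables transfers the shift from \<open>c\<close> to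
      \<open>f\<close>, with opposite sign.\<close>
    have tr: "(LINT p|lborel. f p * c (p + s n *\<^sub>R e)) = (LINT p|lborel. f (p - s n *\<^sub>R e) * c p)"
      using integral_lborel_translate[of "\<lambda>p. f (p - s n *\<^sub>R e) * c p" "s n *\<^sub>R e"]
        borel_measurable_continuous_onI[OF continuous_translate[OF F(4), of "- s n *\<^sub>R e"]]
        borel_measurable_continuous_onI[OF G(2)]
      by (auto intro!: borel_measurable_times)
    have ia: "integrable lborel (\<lambda>p. f p * c (p + s n *\<^sub>R e))"
      by (rule integrable_bdd_support[OF continuous_on_mult[OF F(4) continuous_translate[OF G(2)]]])
        (rule bdd_support_subset[OF bdd_support_translate[OF bc, of "s n *\<^sub>R e"]], simp)
    have ib: "integrable lborel (\<lambda>p. f p * c p)"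
      by (rule integrable_bdd_support[OF continuous_on_mult[OF F(4) G(2)]])
        (rule bdd_support_subset[OF bc], simp)
    have ic: "integrable lborel (\<lambda>p. f (p - s n *\<^sub>R e) * c p)"
      using integrable_bdd_support[OF continuous_on_mult[OF continuous_translate[OF F(4), of "- s n *\<^sub>R e"] G(2)]]
        bdd_support_subset[OF bc, of "\<lambda>p. f (p + - s n *\<^sub>R e) * c p"] by simp
    have "(LINT p|lborel. (g (p + s n *\<^sub>R e) - g p) / s n * a p)
        = (LINT p|lborel. a p * ((1 / s n) * (g (p + s n *\<^sub>R e) + (- 1) * g p)))"
      by (rule Bochner_Integration.integral_cong) (auto simp: field_simps)
    also have "\<dots> = - (LINT p|lborel. f p * ((1 / s n) * (c (p + s n *\<^sub>R e) + (- 1) * c p)))"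
      by (rule integration_by_parts(1)[OF f D Ds])
    also have "(LINT p|lborel. f p * ((1 / s n) * (c (p + s n *\<^sub>R e) + (- 1) * c p)))
        = (LINT p|lborel. (1 / s n) * (f p * c (p + s n *\<^sub>R e) - f p * c p))"
      by (rule Bochner_Integration.integral_cong) (auto simp: algebra_simps)
    also have "\<dots> = (1 / s n) * ((LINT p|lborel. f (p - s n *\<^sub>R e) * c p) - (LINT p|lborel. f p * c p))"
      using ia ib by (simp add: tr)
    also have "\<dots> = (LINT p|lborel. (1 / s n) * (f (p - s n *\<^sub>R e) * c p - f p * c p))"
      using ic ib by simp
    also have "- \<dots> = (LINT p|lborel. - ((1 / s n) * (f (p - s n *\<^sub>R e) * c p - f p * c p)))"
      by simp
    also have "\<dots> = (LINT p|lborel. (f (p + (- s n) *\<^sub>R e) - f p) / (- s n) * c p)"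
      by (rule Bochner_Integration.integral_cong) (use s0 in \<open>auto simp: field_simps\<close>)
    finally show ?thesis .
  qed
  have "(\<lambda>n. LINT p|lborel. (g (p + s n *\<^sub>R e) - g p) / s n * a p)
      \<longlonglongrightarrow> (LINT p|lborel. (fst e * c p + snd e * d p) * a p)"
    unfolding s_def by (rule difference_quotient_tendsto_integral'[OF g F(2) inverse_Suc_seq(1-3) e])
  moreover have "(\<lambda>n. LINT p|lborel. (f (p + (- s n) *\<^sub>R e) - f p) / (- s n) * c p)
      \<longlonglongrightarrow> (LINT p|lborel. (fst e * a p + snd e * b p) * c p)"
    unfolding s_def
    by (rule difference_quotient_tendsto_integral[OF f integrable_bdd_support[OF G(2) bc] bc inverse_Suc_seq(4-6) e])
  ultimately show ?thesis
    unfolding eq using LIMSEQ_unique by (fastforce simp: e_def mult.commute)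
qed

section \<open>A C1 bump profile and the fundamental lemma of the calculus of variations\<close>

lemma has_real_derivative_max_0_square:
  "((\<lambda>t. (max 0 t)\<^sup>2) has_real_derivative 2 * max 0 t) (at t)"
proof (cases t "0::real" rule: linorder_cases)
  case less
  have "((\<lambda>_. 0) has_real_derivative 2 * max 0 t) (at t)" using less by (auto intro!: derivative_eq_intros)
  then show ?thesis
    by (rule has_field_derivative_transform_within_open[where S = "{..<0}"]) (use less in auto)
next
  \<comment> \<open>At the kink the difference quotient is at most \<open>\<bar>h\<bar>\<close> in
    absolute value, so both branches meet with derivative 0.\<close>
  case equal
  have "((\<lambda>h. ((max 0 (t + h))\<^sup>2 - (max 0 t)\<^sup>2) / h) \<longlongrightarrow> 0) (at 0)"
  proof (rule Lim_null_comparison)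
    show "\<forall>\<^sub>F h in at 0. norm (((max 0 (t + h))\<^sup>2 - (max 0 t)\<^sup>2) / h) \<le> \<bar>h\<bar>"
      by (auto simp: equal eventually_at_filter max_def power2_eq_square)
    show "((\<lambda>h. \<bar>h\<bar>) \<longlongrightarrow> (0::real)) (at 0)" by (intro tendsto_rabs_zero tendsto_ident_at)
  qed
  then show ?thesis by (simp add: DERIV_def equal)
next
  case greater
  have "((\<lambda>t. t ^ 2) has_real_derivative 2 * max 0 t) (at t)"
    using greater by (auto intro!: derivative_eq_intros)
  then show ?thesis
    by (rule has_field_derivative_transform_within_open[where S = "{0<..}"]) (use greater in auto)
qed

text \<open>If \<open>f p\<close> were nonzero, \<open>f\<close> would keep its sign on a ball. A C1
  bump that is positive exactly on that ball makes \<open>f p * f q * bump\<close> nonnegative with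
  integral 0, hence 0 almost everywhere, so the ball would be a null set.\<close>

lemma integral_mult_eq_0_imp_eq_0:
  assumes f: "continuous_on UNIV f"
    and z: "\<And>g c d. has_partials g c d \<Longrightarrow> bdd_support g \<Longrightarrow> (LINT p|lborel. f p * g p) = 0"
  shows "f p = 0"
proof (rule ccontr)
  assume f0: "f p \<noteq> 0"
  define m where "m t = (max 0 (t::real))\<^sup>2" for t
  have m': "(m has_real_derivative 2 * max 0 t) (at t)" for t
    unfolding m_def by (rule has_real_derivative_max_0_square)
  \<comment> \<open>The product \<open>f q * f p\<close> treats both signs of \<open>f p\<close> at
    once: it is positive where \<open>f\<close> has the sign of \<open>f p\<close>.\<close>
  have "(f \<longlongrightarrow> f p) (at p)" using f unfolding continuous_on_def by blast
  then have "((\<lambda>q. f q * f p) \<longlongrightarrow> f p * f p) (at p)" by (intro tendsto_intros)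
  then have "\<forall>\<^sub>F q in at p. f q * f p > 0"
    by (rule order_tendstoD(1)) (use f0 in \<open>auto simp: zero_less_mult_iff linorder_neq_iff\<close>)
  then obtain r where r: "r > 0" "\<And>q. dist q p < r \<Longrightarrow> f q * f p > 0"
    using f0 unfolding eventually_at by (metis UNIV_I not_real_square_gt_zero)
  define w where "w q = r\<^sup>2 - ((fst q - fst p)\<^sup>2 + (snd q - snd p)\<^sup>2)" for q :: "real \<times> real"
  have w: "w q = r\<^sup>2 - (dist q p)\<^sup>2" for q
    by (simp add: w_def dist_prod_def dist_real_def)
  have "has_partials w (\<lambda>q. - 2 * (fst q - fst p)) (\<lambda>q. - 2 * (snd q - snd p))"
    unfolding has_partials_def w_def
    by (auto intro!: derivative_eq_intros continuous_intros simp: fun_eq_iff algebra_simps)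
  note P = has_partials_compose[OF this m']
  have P: "has_partials (\<lambda>q. m (w q)) (\<lambda>q. 2 * max 0 (w q) * (- 2 * (fst q - fst p)))
      (\<lambda>q. 2 * max 0 (w q) * (- 2 * (snd q - snd p)))"
    by (rule P) (intro continuous_intros)
  have mw: "m (w q) = 0 \<longleftrightarrow> dist q p \<ge> r" "m (w q) \<ge> 0" for q
  proof -
    have "m (w q) = 0 \<longleftrightarrow> r\<^sup>2 \<le> (dist q p)\<^sup>2" by (auto simp: m_def w)
    also have "\<dots> \<longleftrightarrow> r \<le> dist q p" using r(1) by (intro power2_le_iff_abs_le[THEN trans]) auto
    finally show "m (w q) = 0 \<longleftrightarrow> dist q p \<ge> r" .
  qed (simp add: m_def)
  have bs: "bdd_support (\<lambda>q. m (w q))"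
    unfolding bdd_support_def by (rule bounded_subset[OF bounded_ball[of p r]]) (auto simp: mw dist_commute)
  have z0: "(LINT q|lborel. f p * (f q * m (w q))) = 0" using z[OF P bs] by simp
  have ct: "continuous_on UNIV (\<lambda>q. f p * (f q * m (w q)))"
    by (intro continuous_intros f has_partialsD(4)[OF P])
  have int: "integrable lborel (\<lambda>q. f p * (f q * m (w q)))"
    by (rule integrable_bdd_support[OF ct bdd_support_subset[OF bs]]) simp
  have nn: "f p * (f q * m (w q)) \<ge> 0" for q
  proof (cases "dist q p < r")
    case True then show ?thesis using r(2)[OF True] mw(2)[of q]
      by (metis less_eq_real_def mult.assoc mult.commute mult_nonneg_nonneg)
  next
    case False then have "m (w q) = 0" using mw(1) by auto
    then show ?thesis by simp
  qed
  have "AE q in lborel. f p * (f q * m (w q)) = 0"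
    using integral_nonneg_eq_0_iff_AE[OF int] nn z0 by simp
  then have "AE q in lborel. q \<notin> ball p r"
  proof (rule AE_mp, intro AE_I2 impI)
    fix q assume "f p * (f q * m (w q)) = 0"
    then show "q \<notin> ball p r" using r(2)[of q] mw(1)[of q] by (auto simp: dist_commute)
  qed
  then have "emeasure lborel (ball p r) = 0"
    by (subst (asm) AE_iff_measurable[where N = "ball p r"]) auto
  then have "negligible (ball p r)"
    by (simp add: negligible_iff_null_sets null_sets_completionI null_setsI)
  then show False using open_not_negligible[of "ball p r"] r(1) by auto
qed

section \<open>Null vectors of the stability form\<close>

text \<open>A class closed under sums and under products with continuous functions. Integrability of
  every integrand below follows from its syntactic shape.\<close>

definition cont_bdd_support :: "(real \<times> real \<Rightarrow> real) \<Rightarrow> bool" where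
  "cont_bdd_support f \<longleftrightarrow> continuous_on UNIV f \<and> bdd_support f"

lemma cont_bdd_support_integrable: "cont_bdd_support f \<Longrightarrow> integrable lborel f"
  by (simp add: cont_bdd_support_def integrable_bdd_support)

lemma cont_bdd_support_add: "cont_bdd_support f \<Longrightarrow> cont_bdd_support g \<Longrightarrow> cont_bdd_support (\<lambda>p. f p + g p)"
  by (simp add: cont_bdd_support_def bdd_support_add continuous_on_add)

lemma cont_bdd_support_sum:
  "(\<And>i. i \<in> I \<Longrightarrow> cont_bdd_support (f i)) \<Longrightarrow> cont_bdd_support (\<lambda>p. \<Sum>i\<in>I. f i p)"
proof (induction I rule: infinite_finite_induct)
  case (insert i I)
  then show ?case by (simp add: cont_bdd_support_add)
qed (auto simp: cont_bdd_support_def bdd_support_def)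

lemma cont_bdd_support_mult_right: 
  "cont_bdd_support f \<Longrightarrow> continuous_on UNIV g \<Longrightarrow> cont_bdd_support (\<lambda>p. f p * g p)"
  unfolding cont_bdd_support_def by (auto intro: continuous_on_mult bdd_support_subset)

lemma cont_bdd_support_mult_left: 
  "continuous_on UNIV f \<Longrightarrow> cont_bdd_support g \<Longrightarrow> cont_bdd_support (\<lambda>p. f p * g p)"
  unfolding cont_bdd_support_def by (auto intro: continuous_on_mult bdd_support_subset)

lemma cont_bdd_support_partials:
  assumes "has_partials f a b" "bdd_support f"
  shows "cont_bdd_support f" "cont_bdd_support a" "cont_bdd_support b"
  using has_partialsD[OF assms(1)] bdd_support_partials[OF assms] assms(2)
  by (auto simp: cont_bdd_support_def)

text \<open>The integrand of the stability form with potential matrix \<open>h\<close>. The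
  arguments \<open>a\<close> and \<open>b\<close> stand for the partials of \<zeta>, and the weight
  \<open>(fst p)\<^sup>2\<close> comes from \<open>Y = x \<partial>\<^sub>y\<close>.\<close>

definition energy_density ::
  "('m::finite \<Rightarrow> 'm \<Rightarrow> real \<times> real \<Rightarrow> real) \<Rightarrow> ('m \<Rightarrow> real \<times> real \<Rightarrow> real) \<Rightarrow>
   ('m \<Rightarrow> real \<times> real \<Rightarrow> real) \<Rightarrow> ('m \<Rightarrow> real \<times> real \<Rightarrow> real) \<Rightarrow> real \<times> real \<Rightarrow> real" where
  "energy_density h \<zeta> a b p =
    (\<Sum>i\<in>UNIV. (a i p)\<^sup>2 + (fst p)\<^sup>2 * (b i p)\<^sup>2 + (\<Sum>j\<in>UNIV. h i j p * \<zeta> i p * \<zeta> j p))"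

lemma cont_bdd_support_energy_density:
  assumes "\<And>i j. continuous_on UNIV (h i j)"
    and "\<And>i. has_partials (\<zeta> i) (a i) (b i)" "\<And>i. bdd_support (\<zeta> i)"
  shows "cont_bdd_support (energy_density h \<zeta> a b)"
  unfolding energy_density_def power2_eq_square
  by (intro cont_bdd_support_sum cont_bdd_support_add cont_bdd_support_mult_left continuous_on_mult
      continuous_on_fst continuous_on_id cont_bdd_support_partials[OF assms(2,3)]
      has_partialsD(2,3,4)[OF assms(2)] assms(1))

text \<open>Polarization of a quadratic form. Symmetry of \<open>h\<close> merges the two mixed
  potential sums into one with factor 2, leaving the integrand of the weak linearized equation as
  polar form.\<close>

lemma energy_density_add:
  assumes "\<And>i j p. h i j p = h j i p"
  shows "energy_density h (\<lambda>i p. \<zeta> i p + t * \<xi> i p) (\<lambda>i p. a i p + t * c i p) (\<lambda>i p. b i p + t * d i p) p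
    = energy_density h \<zeta> a b p
      + 2 * t * (\<Sum>i\<in>UNIV. a i p * c i p + (fst p)\<^sup>2 * b i p * d i p + (\<Sum>j\<in>UNIV. h i j p * \<zeta> j p) * \<xi> i p)
      + t\<^sup>2 * energy_density h \<xi> c d p"
proof -
  have sw: "(\<Sum>i\<in>UNIV. \<Sum>j\<in>UNIV. h i j p * \<zeta> i p * \<xi> j p)
      = (\<Sum>i\<in>UNIV. \<Sum>j\<in>UNIV. h i j p * \<zeta> j p * \<xi> i p)"
    by (subst sum.swap) (simp add: assms[of _ _ p, symmetric] cong: sum.cong)
  have "(\<Sum>i\<in>UNIV. \<Sum>j\<in>UNIV. h i j p * (\<zeta> i p + t * \<xi> i p) * (\<zeta> j p + t * \<xi> j p))
    = (\<Sum>i\<in>UNIV. \<Sum>j\<in>UNIV. h i j p * \<zeta> i p * \<zeta> j p)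
      + t * (\<Sum>i\<in>UNIV. \<Sum>j\<in>UNIV. h i j p * \<zeta> i p * \<xi> j p)
      + t * (\<Sum>i\<in>UNIV. \<Sum>j\<in>UNIV. h i j p * \<zeta> j p * \<xi> i p)
      + t\<^sup>2 * (\<Sum>i\<in>UNIV. \<Sum>j\<in>UNIV. h i j p * \<xi> i p * \<xi> j p)"
    unfolding sum_distrib_left sum.distrib[symmetric]
    by (intro sum.cong refl) (simp add: algebra_simps power2_eq_square)
  then have hs: "(\<Sum>i\<in>UNIV. \<Sum>j\<in>UNIV. h i j p * (\<zeta> i p + t * \<xi> i p) * (\<zeta> j p + t * \<xi> j p))
    = (\<Sum>i\<in>UNIV. \<Sum>j\<in>UNIV. h i j p * \<zeta> i p * \<zeta> j p)
      + 2 * t * (\<Sum>i\<in>UNIV. (\<Sum>j\<in>UNIV. h i j p * \<zeta> j p) * \<xi> i p)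
      + t\<^sup>2 * (\<Sum>i\<in>UNIV. \<Sum>j\<in>UNIV. h i j p * \<xi> i p * \<xi> j p)"
    unfolding sw sum_distrib_right by linarith
  have "(\<Sum>i\<in>UNIV. (a i p + t * c i p)\<^sup>2 + (fst p)\<^sup>2 * (b i p + t * d i p)\<^sup>2)
     = (\<Sum>i\<in>UNIV. (a i p)\<^sup>2 + (fst p)\<^sup>2 * (b i p)\<^sup>2)
      + 2 * t * (\<Sum>i\<in>UNIV. a i p * c i p + (fst p)\<^sup>2 * b i p * d i p)
      + t\<^sup>2 * (\<Sum>i\<in>UNIV. (c i p)\<^sup>2 + (fst p)\<^sup>2 * (d i p)\<^sup>2)"
    unfolding sum_distrib_left sum.distrib[symmetric]
    by (intro sum.cong refl) (simp add: algebra_simps power2_eq_square)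
  with hs show ?thesis
    unfolding energy_density_def by (simp add: sum.distrib algebra_simps)
qed

text \<open>The weak equation is tested with \<open>\<phi>\<^sup>2 v\<^sub>i\<close>. Pointwise,
  \<open>|\<nabla>(\<phi> v)|\<^sup>2 = \<nabla>v \<cdot> \<nabla>(\<phi>\<^sup>2 v) + v\<^sup>2
  |\<nabla>\<phi>|\<^sup>2\<close>, so the energy of a truncation consists of the residual term and
  of a term that sees only the gradient of the cutoff.\<close>

lemma integral_energy_density_cutoff:
  assumes hc: "\<And>i j. continuous_on UNIV (h i j)"
    and v: "\<And>i. has_partials (v i) (vx i) (vy i)"
    and k: "\<And>i. continuous_on UNIV (\<kappa> i)"
    and weak: "\<And>i \<psi> a b. has_partials \<psi> a b \<Longrightarrow> bdd_support \<psi> \<Longrightarrow>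
      (LINT p|lborel. vx i p * a p + (fst p)\<^sup>2 * vy i p * b p + (\<Sum>j\<in>UNIV. h i j p * v j p) * \<psi> p)
      = (LINT p|lborel. \<kappa> i p * \<psi> p)"
    and \<phi>: "has_partials \<phi> \<phi>x \<phi>y" "bdd_support \<phi>"
  shows "(LINT p|lborel. energy_density h (\<lambda>i p. \<phi> p * v i p)
            (\<lambda>i p. \<phi>x p * v i p + \<phi> p * vx i p) (\<lambda>i p. \<phi>y p * v i p + \<phi> p * vy i p) p)
    = (\<Sum>i\<in>UNIV. LINT p|lborel. \<kappa> i p * ((\<phi> p)\<^sup>2 * v i p))
      + (\<Sum>i\<in>UNIV. LINT p|lborel. (v i p)\<^sup>2 * ((\<phi>x p)\<^sup>2 + (fst p)\<^sup>2 * (\<phi>y p)\<^sup>2))"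
proof -
  define \<psi> where "\<psi> i p = (\<phi> p * \<phi> p) * v i p" for i p
  define a where "a i p = (\<phi>x p * \<phi> p + \<phi> p * \<phi>x p) * v i p + (\<phi> p * \<phi> p) * vx i p" for i p
  define b where "b i p = (\<phi>y p * \<phi> p + \<phi> p * \<phi>y p) * v i p + (\<phi> p * \<phi> p) * vy i p" for i p
  have \<psi>: "has_partials (\<psi> i) (a i) (b i)" for i
    unfolding \<psi>_def a_def b_def by (intro has_partials_mult \<phi> v)
  have \<psi>s: "bdd_support (\<psi> i)" for i
    by (rule bdd_support_subset[OF \<phi>(2)]) (simp add: \<psi>_def)
  have i1: "integrable lborel (\<lambda>p. vx i p * a i p + (fst p)\<^sup>2 * vy i p * b i p + (\<Sum>j\<in>UNIV. h i j p * v j p) * \<psi> i p)" for i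
    by (intro cont_bdd_support_integrable cont_bdd_support_add cont_bdd_support_mult_left continuous_on_mult
        continuous_on_power continuous_on_sum
      continuous_on_fst continuous_on_id cont_bdd_support_partials[OF \<psi> \<psi>s]
      has_partialsD(2,3,4)[OF v] hc)
  have i2: "integrable lborel (\<lambda>p. (v i p)\<^sup>2 * ((\<phi>x p)\<^sup>2 + (fst p)\<^sup>2 * (\<phi>y p)\<^sup>2))" for i
    unfolding power2_eq_square
    by (intro cont_bdd_support_integrable cont_bdd_support_add cont_bdd_support_mult_left continuous_on_mult
      continuous_on_fst continuous_on_id cont_bdd_support_partials[OF \<phi>]
      has_partialsD(2,3,4)[OF \<phi>(1)] has_partialsD(2,3,4)[OF v])
  have "energy_density h (\<lambda>i p. \<phi> p * v i p)
            (\<lambda>i p. \<phi>x p * v i p + \<phi> p * vx i p) (\<lambda>i p. \<phi>y p * v i p + \<phi> p * vy i p) p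
    = (\<Sum>i\<in>UNIV. (vx i p * a i p + (fst p)\<^sup>2 * vy i p * b i p + (\<Sum>j\<in>UNIV. h i j p * v j p) * \<psi> i p)
       + (v i p)\<^sup>2 * ((\<phi>x p)\<^sup>2 + (fst p)\<^sup>2 * (\<phi>y p)\<^sup>2))" for p
    unfolding energy_density_def
  proof (intro sum.cong refl)
    fix i
    have "(\<Sum>j\<in>UNIV. h i j p * (\<phi> p * v i p) * (\<phi> p * v j p)) = (\<Sum>j\<in>UNIV. h i j p * v j p) * \<psi> i p"
      unfolding sum_distrib_right \<psi>_def by (intro sum.cong refl) (simp add: algebra_simps)
    then show "(\<phi>x p * v i p + \<phi> p * vx i p)\<^sup>2 + (fst p)\<^sup>2 * (\<phi>y p * v i p + \<phi> p * vy i p)\<^sup>2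
        + (\<Sum>j\<in>UNIV. h i j p * (\<phi> p * v i p) * (\<phi> p * v j p))
      = (vx i p * a i p + (fst p)\<^sup>2 * vy i p * b i p + (\<Sum>j\<in>UNIV. h i j p * v j p) * \<psi> i p)
       + (v i p)\<^sup>2 * ((\<phi>x p)\<^sup>2 + (fst p)\<^sup>2 * (\<phi>y p)\<^sup>2)"
      by (simp add: a_def b_def algebra_simps power2_eq_square)
  qed
  then have "(LINT p|lborel. energy_density h (\<lambda>i p. \<phi> p * v i p)
            (\<lambda>i p. \<phi>x p * v i p + \<phi> p * vx i p) (\<lambda>i p. \<phi>y p * v i p + \<phi> p * vy i p) p)
    = (\<Sum>i\<in>UNIV. (LINT p|lborel. vx i p * a i p + (fst p)\<^sup>2 * vy i p * b i p + (\<Sum>j\<in>UNIV. h i j p * v j p) * \<psi> i p)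
       + (LINT p|lborel. (v i p)\<^sup>2 * ((\<phi>x p)\<^sup>2 + (fst p)\<^sup>2 * (\<phi>y p)\<^sup>2)))"
    using i1 i2 by (simp add: Bochner_Integration.integral_sum Bochner_Integration.integral_add)
  also have "\<dots> = (\<Sum>i\<in>UNIV. (LINT p|lborel. \<kappa> i p * \<psi> i p)
       + (LINT p|lborel. (v i p)\<^sup>2 * ((\<phi>x p)\<^sup>2 + (fst p)\<^sup>2 * (\<phi>y p)\<^sup>2)))"
    using weak[OF \<psi> \<psi>s] by simp
  finally show ?thesis by (simp add: sum.distrib \<psi>_def power2_eq_square)
qed

text \<open>A nonnegative quadratic form is degenerate along a minimizing sequence: if the energy of
  the truncations \<open>\<phi> n * v\<close> tends to 0, then their polar form against any fixed test function
  does too, and that polar form is eventually the weak residual \<open>\<kappa>\<close> of \<open>v\<close>.\<close>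

lemma weak_residual_eq_0:
  fixes h :: "'m::finite \<Rightarrow> 'm \<Rightarrow> real \<times> real \<Rightarrow> real"
  assumes hc: "\<And>i j. continuous_on UNIV (h i j)"
    and sym: "\<And>i j p. h i j p = h j i p"
    and stable: "\<And>\<zeta> a b. (\<And>i. has_partials (\<zeta> i) (a i) (b i)) \<Longrightarrow> (\<And>i. bdd_support (\<zeta> i)) \<Longrightarrow>
      0 \<le> (LINT p|lborel. energy_density h \<zeta> a b p)"
    and v: "\<And>i. has_partials (v i) (vx i) (vy i)"
    and k: "\<And>i. continuous_on UNIV (\<kappa> i)"
    and weak: "\<And>i \<psi> a b. has_partials \<psi> a b \<Longrightarrow> bdd_support \<psi> \<Longrightarrow>
      (LINT p|lborel. vx i p * a p + (fst p)\<^sup>2 * vy i p * b p + (\<Sum>j\<in>UNIV. h i j p * v j p) * \<psi> p)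
      = (LINT p|lborel. \<kappa> i p * \<psi> p)"
    and \<phi>: "\<And>n. has_partials (\<phi> n) (\<phi>x n) (\<phi>y n)" "\<And>n. bdd_support (\<phi> n)"
    and flat: "\<And>r. \<forall>\<^sub>F n in sequentially. \<forall>p\<in>cball 0 r. \<phi> n p = 1 \<and> \<phi>x n p = 0 \<and> \<phi>y n p = 0"
    and lim: "(\<lambda>n. LINT p|lborel. energy_density h (\<lambda>i p. \<phi> n p * v i p)
            (\<lambda>i p. \<phi>x n p * v i p + \<phi> n p * vx i p) (\<lambda>i p. \<phi>y n p * v i p + \<phi> n p * vy i p) p) \<longlonglongrightarrow> 0"
  shows "\<kappa> i p = 0"
proof (rule integral_mult_eq_0_imp_eq_0[OF k])
  fix \<psi> c d assume \<psi>: "has_partials \<psi> c d" "bdd_support \<psi>"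
  define I where "I = (LINT p|lborel. \<kappa> i p * \<psi> p)"
  \<comment> \<open>The perturbation lives in component \<open>i\<close> only, which isolates the
    \<open>i\<close>-th equation in the polar form.\<close>
  define \<xi> where "\<xi> = (\<lambda>j. if j = i then \<psi> else (\<lambda>_. 0))"
  define cc where "cc = (\<lambda>j. if j = i then c else (\<lambda>_. 0))"
  define dd where "dd = (\<lambda>j. if j = i then d else (\<lambda>_. 0))"
  have \<xi>: "has_partials (\<xi> j) (cc j) (dd j)" "bdd_support (\<xi> j)" for j
    using \<psi> has_partials_const[of 0] by (auto simp: \<xi>_def cc_def dd_def bdd_support_def)
  define K where "K = (LINT p|lborel. energy_density h \<xi> cc dd p)"
  define e where "e n = (LINT p|lborel. energy_density h (\<lambda>i p. \<phi> n p * v i p)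
            (\<lambda>i p. \<phi>x n p * v i p + \<phi> n p * vx i p) (\<lambda>i p. \<phi>y n p * v i p + \<phi> n p * vy i p) p)" for n
  obtain r1 r2 r3 where r: "\<And>p. norm p > r1 \<Longrightarrow> \<psi> p = 0" "\<And>p. norm p > r2 \<Longrightarrow> c p = 0" "\<And>p. norm p > r3 \<Longrightarrow> d p = 0"
    using bdd_supportE[OF \<psi>(2)] bdd_supportE[OF bdd_support_partials(1)[OF \<psi>]]
      bdd_supportE[OF bdd_support_partials(2)[OF \<psi>]] by metis
  \<comment> \<open>This is stability for the truncation perturbed by \<open>t\<close> times \<xi>.
    Once the cutoff is identically 1 on a ball carrying \<psi> and its partials, the cross term no
    longer depends on \<open>n\<close> and equals \<open>I\<close>.\<close>
  have ev: "\<forall>\<^sub>F n in sequentially. \<forall>t. 0 \<le> e n + 2 * t * I + t\<^sup>2 * K"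
    using flat[of "max r1 (max r2 r3)"]
  proof eventually_elim
    case (elim n)
    show ?case
    proof
      fix t
      define V where "V = (\<lambda>i p. \<phi> n p * v i p)"
      define A where "A = (\<lambda>i p. \<phi>x n p * v i p + \<phi> n p * vx i p)"
      define B where "B = (\<lambda>i p. \<phi>y n p * v i p + \<phi> n p * vy i p)"
      have V: "has_partials (V j) (A j) (B j)" "bdd_support (V j)" for j
        unfolding V_def A_def B_def
        using has_partials_mult[OF \<phi>(1)[of n] v[of j]] bdd_support_subset[OF \<phi>(2)[of n], of "\<lambda>p. \<phi> n p * v j p"]
        by auto
      have W: "has_partials (\<lambda>p. V j p + t * \<xi> j p) (\<lambda>p. A j p + t * cc j p) (\<lambda>p. B j p + t * dd j p)"
        "bdd_support (\<lambda>p. V j p + t * \<xi> j p)" for j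
        by (auto intro!: has_partials_add has_partials_cmult V \<xi> bdd_support_add
            intro: bdd_support_subset[OF \<xi>(2)[of j]])
      have cross: "(\<Sum>j\<in>UNIV. A j p * cc j p + (fst p)\<^sup>2 * B j p * dd j p + (\<Sum>k\<in>UNIV. h j k p * V k p) * \<xi> j p)
          = vx i p * c p + (fst p)\<^sup>2 * vy i p * d p + (\<Sum>j\<in>UNIV. h i j p * v j p) * \<psi> p" for p
      proof -
        have "(\<Sum>j\<in>UNIV. A j p * cc j p + (fst p)\<^sup>2 * B j p * dd j p + (\<Sum>k\<in>UNIV. h j k p * V k p) * \<xi> j p)
          = (\<Sum>j\<in>UNIV. if j = i then A i p * c p + (fst p)\<^sup>2 * B i p * d p + (\<Sum>k\<in>UNIV. h i k p * V k p) * \<psi> p else 0)"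
          by (intro sum.cong refl) (auto simp: \<xi>_def cc_def dd_def)
        also have "\<dots> = A i p * c p + (fst p)\<^sup>2 * B i p * d p + (\<Sum>k\<in>UNIV. h i k p * V k p) * \<psi> p"
          by simp
        also have "\<dots> = vx i p * c p + (fst p)\<^sup>2 * vy i p * d p + (\<Sum>j\<in>UNIV. h i j p * v j p) * \<psi> p"
        proof (cases "norm p \<le> max r1 (max r2 r3)")
          case True
          then have "\<phi> n p = 1" "\<phi>x n p = 0" "\<phi>y n p = 0" using elim by auto
          then show ?thesis by (simp add: A_def B_def V_def)
        next
          case False
          then have "\<psi> p = 0" "c p = 0" "d p = 0" using r by auto
          then show ?thesis by simp
        qed
        finally show ?thesis .
      qed
      have "0 \<le> (LINT p|lborel. energy_density h (\<lambda>j p. V j p + t * \<xi> j p) (\<lambda>j p. A j p + t * cc j p) (\<lambda>j p. B j p + t * dd j p) p)"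
        by (rule stable[OF W])
      also have "\<dots> = (LINT p|lborel. energy_density h V A B p + 2 * t * (vx i p * c p + (fst p)\<^sup>2 * vy i p * d p + (\<Sum>j\<in>UNIV. h i j p * v j p) * \<psi> p)
          + t\<^sup>2 * energy_density h \<xi> cc dd p)"
        unfolding energy_density_add[OF sym] cross ..
      also have "\<dots> = (LINT p|lborel. energy_density h V A B p) + 2 * t * (LINT p|lborel. vx i p * c p + (fst p)\<^sup>2 * vy i p * d p + (\<Sum>j\<in>UNIV. h i j p * v j p) * \<psi> p)
          + t\<^sup>2 * K"
      proof -
        have 1: "integrable lborel (\<lambda>p. vx i p * c p + (fst p)\<^sup>2 * vy i p * d p + (\<Sum>j\<in>UNIV. h i j p * v j p) * \<psi> p)"
          by (intro cont_bdd_support_integrable cont_bdd_support_add cont_bdd_support_mult_left continuous_on_mult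
            continuous_on_power continuous_on_sum
            continuous_on_fst continuous_on_id cont_bdd_support_partials[OF \<psi>]
            has_partialsD(2,3,4)[OF v] hc)
        have 2: "integrable lborel (energy_density h V A B)"
          by (intro cont_bdd_support_integrable cont_bdd_support_energy_density hc V)
        have 3: "integrable lborel (energy_density h \<xi> cc dd)"
          by (intro cont_bdd_support_integrable cont_bdd_support_energy_density hc \<xi>)
        show ?thesis
          unfolding K_def
          by (simp only: Bochner_Integration.integral_add Bochner_Integration.integrable_add
              integrable_mult_right 1 2 3 integral_mult_right_zero)
      qed
      also have "(LINT p|lborel. vx i p * c p + (fst p)\<^sup>2 * vy i p * d p + (\<Sum>j\<in>UNIV. h i j p * v j p) * \<psi> p) = I"
        unfolding I_def by (rule weak[OF \<psi>])
      finally show "0 \<le> e n + 2 * t * I + t\<^sup>2 * K" by (simp add: e_def V_def A_def B_def)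
    qed
  qed
  have lim': "(\<lambda>n. e n + 2 * t * I + t\<^sup>2 * K) \<longlonglongrightarrow> 0 + 2 * t * I + t\<^sup>2 * K" for t
    using lim unfolding e_def by (intro tendsto_intros)
  \<comment> \<open>Limit in \<open>n\<close> with \<open>t\<close> fixed. A parabola through the
    origin that is nowhere negative must have zero slope there.\<close>
  have q: "0 \<le> 2 * t * I + t\<^sup>2 * K" for t
    using tendsto_lowerbound[OF lim'[of t], of 0] eventually_mono[OF ev, of "\<lambda>n. 0 \<le> e n + 2 * t * I + t\<^sup>2 * K"]
    by simp
  \<comment> \<open>Adding the inequalities at 1 and -1 cancels the linear terms.\<close>
  have "K \<ge> 0" using q[of 1] q[of "-1"] by simp
  show "(LINT p|lborel. \<kappa> i p * \<psi> p) = 0"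
  proof (rule ccontr)
    assume "(LINT p|lborel. \<kappa> i p * \<psi> p) \<noteq> 0"
    \<comment> \<open>The value of the parabola at \<open>- s\<close> is
      \<open>- (s\<^sup>2 * (K + 2))\<close>, which is negative unless \<open>I = 0\<close>. The
      denominator \<open>K + 1\<close> stays positive even when \<open>K = 0\<close>.\<close>
    define s where "s = I / (K + 1)"
    have s: "I = s * (K + 1)" using \<open>K \<ge> 0\<close> by (simp add: s_def)
    then have "s \<noteq> 0" using \<open>(LINT p|lborel. \<kappa> i p * \<psi> p) \<noteq> 0\<close> by (auto simp: I_def)
    then have "s\<^sup>2 * (K + 2) > 0" using \<open>K \<ge> 0\<close> by simp
    moreover have "2 * (- s) * I + (- s)\<^sup>2 * K = - (s\<^sup>2 * (K + 2))"
      unfolding s by (simp add: algebra_simps power2_eq_square)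
    ultimately show False using q[of "- s"] by linarith
  qed
qed

section \<open>Logarithmic cutoffs\<close>

lemma BG_bounded:
  assumes "R > 0" "p \<in> BG R"
  shows "\<bar>fst p\<bar> < R" "\<bar>snd p\<bar> < R\<^sup>2" "norm p \<le> R + R\<^sup>2"
proof -
  have p: "(fst p) ^ 4 + (snd p)\<^sup>2 < R ^ 4" using assms by (auto simp: BG_def)
  have "\<bar>fst p\<bar> ^ 4 < R ^ 4" using p by (simp add: power_even_abs) (smt (verit) zero_le_power2)
  then show 1: "\<bar>fst p\<bar> < R" using power_less_imp_less_base assms(1) by (metis less_eq_real_def)
  have "0 \<le> (fst p) ^ 4" by simp
  then have "(snd p)\<^sup>2 < R ^ 4" using p by linarith
  then have "(snd p)\<^sup>2 < (R\<^sup>2)\<^sup>2" by simp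
  then show 2: "\<bar>snd p\<bar> < R\<^sup>2" by (metis abs_ge_zero power2_abs power2_less_imp_less zero_le_power2)
  show "norm p \<le> R + R\<^sup>2"
    using norm_Pair_le[of "fst p" "snd p"] 1 2 by simp
qed

lemma BG_sets: "BG R \<in> sets borel"
proof -
  have "open {p :: real \<times> real. (fst p) ^ 4 + (snd p)\<^sup>2 < R ^ 4}"
    by (intro open_Collect_less continuous_intros)
  also have "{p :: real \<times> real. (fst p) ^ 4 + (snd p)\<^sup>2 < R ^ 4} = BG R" by (auto simp: BG_def)
  finally show ?thesis by simp
qed

lemma set_integrable_BG:
  fixes f :: "real \<times> real \<Rightarrow> real"
  assumes "continuous_on UNIV f" "R > 0"
  shows "set_integrable lborel (BG R) f"
proof -
  have "integrable lborel (\<lambda>p. indicator (BG R) p *\<^sub>R (f p * indicator (cball 0 (R + R\<^sup>2)) p))"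
    by (intro integrable_mult_indicator integrable_mult_indicator_cball assms) (simp add: BG_sets)
  also have "(\<lambda>p. indicator (BG R) p *\<^sub>R (f p * indicator (cball 0 (R + R\<^sup>2)) p)) = (\<lambda>p. indicator (BG R) p *\<^sub>R f p)"
    using BG_bounded(3)[OF assms(2)] by (auto simp: fun_eq_iff indicator_def)
  finally show ?thesis by (simp add: set_integrable_def)
qed

text \<open>With \<sigma> = 1 + x^4 + y^2, the fourth power of the homogeneous gauge plus 1, the
  cutoff descends from 1 to 0 linearly in \<open>ln \<sigma>\<close> up to a smooth profile, over
  \<open>16 ^ Suc n \<le> \<sigma> \<le> 16 ^ (2 * Suc n)\<close>. Its squared Grushin gradient is
  at most a multiple of \<open>x\<^sup>2 / \<sigma>\<close> over the square of \<open>Suc n\<close>,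
  and on each dyadic shell \<open>x\<^sup>2 / \<sigma>\<close> is bounded by a single term of the
  sum.\<close>

lemma grushin_log_cutoffs:
  obtains \<phi> \<phi>x \<phi>y :: "nat \<Rightarrow> real \<times> real \<Rightarrow> real" where
    "\<And>n. has_partials (\<phi> n) (\<phi>x n) (\<phi>y n)" "\<And>n. bdd_support (\<phi> n)"
    "\<And>r. \<forall>\<^sub>F n in sequentially. \<forall>p\<in>cball 0 r. \<phi> n p = 1 \<and> \<phi>x n p = 0 \<and> \<phi>y n p = 0"
    "\<And>n p. (\<phi>x n p)\<^sup>2 + (fst p)\<^sup>2 * (\<phi>y n p)\<^sup>2
      \<le> 256 / (real (Suc n))\<^sup>2 * (\<Sum>k<2 * Suc n. (fst p)\<^sup>2 * indicator (BG (2 ^ Suc k)) p / 16 ^ k)"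
proof -
  define m where "m t = (max 0 (t::real))\<^sup>2" for t
  \<comment> \<open>A C1 profile equal to 1 for \<open>t \<le> 0\<close> and to 0 for
    \<open>t \<ge> 1\<close>, as \<open>m t \<ge> 1\<close> there.\<close>
  define \<theta> where "\<theta> t = m (1 - m t)" for t
  define \<theta>' where "\<theta>' t = 2 * max 0 (1 - m t) * (- (2 * max 0 t))" for t
  \<comment> \<open>The summand 1 keeps \<sigma> at least 1, so its logarithm is C1 on the whole
    plane, the origin included.\<close>
  define \<sigma> where "\<sigma> p = 1 + (fst p * fst p) * (fst p * fst p) + snd p * snd p" for p :: "real \<times> real"
  \<comment> \<open>Normalized to be 0 at \<open>\<sigma> = 16 ^ Suc n\<close> and 1 at
    \<open>\<sigma> = 16 ^ (2 * Suc n)\<close>. The base is \<open>16 = 2 ^ 4\<close> because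
    \<open>BG\<close> compares with the fourth power of the radius.\<close>
  define f where "f n p = ln (\<sigma> p) * (1 / (ln 16 * real (Suc n))) + - 1" for n p
  define fx where "fx n p = inverse (\<sigma> p) * (4 * fst p ^ 3) * (1 / (ln 16 * real (Suc n)))" for n p
  define fy where "fy n p = inverse (\<sigma> p) * (2 * snd p) * (1 / (ln 16 * real (Suc n)))" for n p
  have m': "(m has_real_derivative 2 * max 0 t) (at t)" for t
    unfolding m_def by (rule has_real_derivative_max_0_square)
  have \<theta>': "(\<theta> has_real_derivative \<theta>' t) (at t)" for t
    unfolding \<theta>_def \<theta>'_def
    by (rule DERIV_chain2[OF m']) (auto intro!: derivative_eq_intros m')
  have c\<theta>': "continuous_on S \<theta>'" for S
    unfolding \<theta>'_def m_def by (intro continuous_intros)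
  have \<sigma>1: "\<sigma> p \<ge> 1" for p by (simp add: \<sigma>_def)
  have \<sigma>: "has_partials \<sigma> (\<lambda>p. 4 * fst p ^ 3) (\<lambda>p. 2 * snd p)"
    unfolding has_partials_def \<sigma>_def
    by (auto intro!: derivative_eq_intros continuous_intros simp: fun_eq_iff algebra_simps power3_eq_cube)
  have ln\<sigma>: "has_partials (\<lambda>p. ln (\<sigma> p)) (\<lambda>p. inverse (\<sigma> p) * (4 * fst p ^ 3)) (\<lambda>p. inverse (\<sigma> p) * (2 * snd p))"
  proof (rule has_partials_compose[OF \<sigma>])
    fix p show "(ln has_real_derivative inverse (\<sigma> p)) (at (\<sigma> p))"
      using \<sigma>1[of p] by (intro DERIV_ln) simp
    show "continuous_on (range \<sigma>) inverse"
      by (intro continuous_on_inverse continuous_on_id) (auto, metis \<sigma>1 not_one_le_zero)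
  qed
  have f: "has_partials (f n) (fx n) (fy n)" for n
    unfolding f_def fx_def fy_def
    using has_partials_add[OF has_partials_mult[OF ln\<sigma> has_partials_const[of "1 / (ln 16 * real (Suc n))"]] has_partials_const[of "- 1"]]
    by simp
  define \<phi> where "\<phi> n p = \<theta> (f n p)" for n p
  define \<phi>x where "\<phi>x n p = \<theta>' (f n p) * fx n p" for n p
  define \<phi>y where "\<phi>y n p = \<theta>' (f n p) * fy n p" for n p
  have 1: "has_partials (\<phi> n) (\<phi>x n) (\<phi>y n)" for n
    unfolding \<phi>_def \<phi>x_def \<phi>y_def by (rule has_partials_compose[OF f \<theta>' c\<theta>'])
  have ln16: "ln (16::real) > 0" by simp
  have f_ge: "f n p \<ge> 1 \<longleftrightarrow> 16 ^ (2 * Suc n) \<le> \<sigma> p" for n p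
  proof -
    have "f n p \<ge> 1 \<longleftrightarrow> real (2 * Suc n) * ln 16 \<le> ln (\<sigma> p)"
      using pos_le_divide_eq[of "ln 16 * real (Suc n)" 2 "ln (\<sigma> p)"] ln16
      by (simp add: f_def algebra_simps del: of_nat_Suc) (simp add: algebra_simps)
    also have "\<dots> \<longleftrightarrow> ln (16 ^ (2 * Suc n)) \<le> ln (\<sigma> p)"
      by (simp only: ln_realpow[of 16 "2 * Suc n"])
    also have "\<dots> \<longleftrightarrow> 16 ^ (2 * Suc n) \<le> \<sigma> p"
      using \<sigma>1[of p] by (intro ln_le_cancel_iff) auto
    finally show ?thesis .
  qed
  have f_le: "f n p \<le> 0 \<longleftrightarrow> \<sigma> p \<le> 16 ^ Suc n" for n p
  proof -
    have "f n p \<le> 0 \<longleftrightarrow> ln (\<sigma> p) \<le> real (Suc n) * ln 16"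
      using pos_divide_le_eq[of "ln 16 * real (Suc n)" "ln (\<sigma> p)" 1] ln16
      by (simp add: f_def algebra_simps del: of_nat_Suc)
    also have "\<dots> \<longleftrightarrow> ln (\<sigma> p) \<le> ln (16 ^ Suc n)"
      by (simp only: ln_realpow[of 16 "Suc n"])
    also have "\<dots> \<longleftrightarrow> \<sigma> p \<le> 16 ^ Suc n"
      using \<sigma>1[of p] by (intro ln_le_cancel_iff) auto
    finally show ?thesis .
  qed
  have \<theta>_le: "\<theta> t = 1" "\<theta>' t = 0" if "t \<le> 0" for t
    using that by (auto simp: \<theta>_def \<theta>'_def m_def)
  have \<theta>_ge: "\<theta> t = 0" "\<theta>' t = 0" if "t \<ge> 1" for t
  proof -
    have "m t \<ge> 1" using that by (simp add: m_def)
    then show "\<theta> t = 0" "\<theta>' t = 0" by (auto simp: \<theta>_def \<theta>'_def m_def[of "1 - m t"])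
  qed
  \<comment> \<open>Between 0 and 1 the absolute value of the derivative is
    \<open>4 * (1 - m t) * t\<close>, hence at most 4.\<close>
  have \<theta>'_bd: "(\<theta>' t)\<^sup>2 \<le> 16" for t
  proof (cases "0 < t \<and> t < 1")
    case True
    then have "m t \<le> 1" "m t \<ge> 0" by (auto simp: m_def power_le_one)
    then have "(1 - m t) * t \<le> 1 * 1" using True by (intro mult_mono) auto
    then have "\<bar>\<theta>' t\<bar> \<le> 4" using True \<open>m t \<le> 1\<close> by (simp add: \<theta>'_def abs_mult algebra_simps)
    then show ?thesis using power_mono[of "\<bar>\<theta>' t\<bar>" 4 2] by simp
  next
    case False
    then show ?thesis using \<theta>_le(2)[of t] \<theta>_ge(2)[of t] by auto
  qed
  \<comment> \<open>The 1 on the right is the one in \<sigma>; in particular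
    \<open>\<sigma> p < 16 ^ k\<close> suffices for membership.\<close>
  have BG: "p \<in> BG (2 ^ k) \<longleftrightarrow> \<sigma> p < 1 + 16 ^ k" for p k
  proof -
    have "((2::real) ^ k) ^ 4 = (2 ^ 4) ^ k" by (simp only: power_mult[symmetric] mult.commute)
    then show ?thesis
      by (cases p) (simp add: BG_def \<sigma>_def power4_eq_xxxx power2_eq_square mult.assoc)
  qed
  have 2: "bdd_support (\<phi> n)" for n
    unfolding bdd_support_def bounded_iff
  proof (intro exI ballI)
    fix p assume "p \<in> {p. \<phi> n p \<noteq> 0}"
    then have "f n p < 1" using \<theta>_ge(1)[of "f n p"] by (force simp: \<phi>_def)
    then have "p \<in> BG (2 ^ (2 * Suc n))" unfolding BG using f_ge[of n p] by simp
    then show "norm p \<le> 2 ^ (2 * Suc n) + (2 ^ (2 * Suc n))\<^sup>2"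
      by (intro BG_bounded(3)) auto
  qed
  have 3: "\<forall>\<^sub>F n in sequentially. \<forall>p\<in>cball 0 r. \<phi> n p = 1 \<and> \<phi>x n p = 0 \<and> \<phi>y n p = 0" for r
  proof -
    have "compact (\<sigma> ` cball 0 r)"
      by (intro compact_continuous_image continuous_on_subset[OF has_partialsD(4)[OF \<sigma>]]) auto
    then have "bounded (\<sigma> ` cball 0 r)" by (rule compact_imp_bounded)
    then obtain M where "\<forall>s\<in>\<sigma> ` cball 0 r. norm s \<le> M" unfolding bounded_iff by blast
    then have M: "\<bar>\<sigma> p\<bar> \<le> M" if "p \<in> cball 0 r" for p using that by fastforce
    obtain N where N: "M < 16 ^ N" using real_arch_pow[of 16 M] by auto
    show ?thesis
      using eventually_ge_at_top[of N]
    proof eventually_elim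
      case (elim n)
      show ?case
      proof
        fix p :: "real \<times> real" assume "p \<in> cball 0 r"
        then have "\<sigma> p \<le> 16 ^ N" using M[of p] N by linarith
        also have "(16::real) ^ N \<le> 16 ^ Suc n" using elim by (intro power_increasing) auto
        finally have "f n p \<le> 0" by (simp only: f_le)
        then show "\<phi> n p = 1 \<and> \<phi>x n p = 0 \<and> \<phi>y n p = 0"
          using \<theta>_le by (simp add: \<phi>_def \<phi>x_def \<phi>y_def)
      qed
    qed
  qed
  have 4: "(\<phi>x n p)\<^sup>2 + (fst p)\<^sup>2 * (\<phi>y n p)\<^sup>2
      \<le> 256 / (real (Suc n))\<^sup>2 * (\<Sum>k<2 * Suc n. (fst p)\<^sup>2 * indicator (BG (2 ^ Suc k)) p / 16 ^ k)" (is "?L \<le> ?R") for n p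
  proof (cases "f n p \<ge> 1")
    case True
    then have "?L = 0" using \<theta>_ge(2) by (simp add: \<phi>x_def \<phi>y_def)
    also have "0 \<le> ?R" by (intro mult_nonneg_nonneg sum_nonneg divide_nonneg_nonneg) auto
    finally show ?thesis .
  next
    case False
    define x where "x = fst p"
    define y where "y = snd p"
    define N where "N = real (Suc n)"
    have N: "N > 0" by (simp add: N_def)
    \<comment> \<open>This selects the dyadic shell of \<open>p\<close>: with
      \<open>K = Suc k\<close>, \<open>16 ^ k \<le> \<sigma> p < 16 ^ Suc k\<close>. Since
      \<open>K \<le> 2 * Suc n\<close>, the index \<open>k\<close> lies in the range of the
      sum.\<close>
    define K where "K = (LEAST k. \<sigma> p < 16 ^ k)"
    have big: "\<sigma> p < 16 ^ (2 * Suc n)" using False f_ge by (simp add: not_le)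
    have K: "\<sigma> p < 16 ^ K" unfolding K_def using big by (rule LeastI)
    have K': "K \<le> 2 * Suc n" unfolding K_def using big by (rule Least_le)
    have "K \<noteq> 0" using K \<sigma>1[of p] by (intro notI) simp
    then obtain k where k: "K = Suc k" by (cases K) auto
    have "\<not> \<sigma> p < 16 ^ k" using not_less_Least[of k "\<lambda>k. \<sigma> p < 16 ^ k"] k by (simp add: K_def)
    then have lo: "16 ^ k \<le> \<sigma> p" by simp
    have "x\<^sup>2 / \<sigma> p \<le> x\<^sup>2 / 16 ^ k" using lo \<sigma>1[of p] by (intro divide_left_mono) auto
    also have "\<dots> = (fst p)\<^sup>2 * indicator (BG (2 ^ Suc k)) p / 16 ^ k"
      using K unfolding k by (simp add: x_def indicator_def BG del: power_Suc)
    also have "\<dots> \<le> (\<Sum>k<2 * Suc n. (fst p)\<^sup>2 * indicator (BG (2 ^ Suc k)) p / 16 ^ k)"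
      by (rule member_le_sum) (use K' k in auto)
    finally have s: "x\<^sup>2 / \<sigma> p \<le> (\<Sum>k<2 * Suc n. (fst p)\<^sup>2 * indicator (BG (2 ^ Suc k)) p / 16 ^ k)" .
    have ln16': "1 \<le> ln (16::real)"
      using exp_le ln_le_cancel_iff[of "exp 1" "16::real"] by simp
    have "?L = (\<theta>' (f n p))\<^sup>2 * ((4 * x ^ 3)\<^sup>2 + x\<^sup>2 * (2 * y)\<^sup>2) / ((\<sigma> p)\<^sup>2 * (ln 16)\<^sup>2 * N\<^sup>2)"
    proof -
      define r where "r = 1 / (\<sigma> p * ln 16 * N)"
      have "fx n p = r * (4 * x ^ 3)" "fy n p = r * (2 * y)"
        by (simp_all add: fx_def fy_def r_def x_def y_def N_def inverse_eq_divide)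
      then have "?L = (\<theta>' (f n p))\<^sup>2 * ((4 * x ^ 3)\<^sup>2 + x\<^sup>2 * (2 * y)\<^sup>2) * r\<^sup>2"
        by (simp add: \<phi>x_def \<phi>y_def x_def power_mult_distrib algebra_simps)
      then show ?thesis by (simp add: r_def power_divide power_mult_distrib)
    qed
    \<comment> \<open>One factor 16 bounds the squared derivative of the profile. The other comes
      from the squared Grushin gradient of \<sigma>, namely x^2 (16 x^4 + 4 y^2). In the denominator
      \<open>ln 16\<close> is replaced by 1.\<close>
    also have "\<dots> \<le> 16 * (16 * x\<^sup>2 * \<sigma> p) / ((\<sigma> p)\<^sup>2 * 1 * N\<^sup>2)"
    proof (rule frac_le)
      have "(4 * x ^ 3)\<^sup>2 + x\<^sup>2 * (2 * y)\<^sup>2 = x\<^sup>2 * (16 * (x * x * (x * x)) + 4 * (y * y))"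
        by (simp add: power2_eq_square power3_eq_cube algebra_simps)
      also have "\<dots> \<le> x\<^sup>2 * (16 * \<sigma> p)"
        by (intro mult_left_mono) (auto simp: \<sigma>_def x_def y_def)
      finally have "(4 * x ^ 3)\<^sup>2 + x\<^sup>2 * (2 * y)\<^sup>2 \<le> 16 * x\<^sup>2 * \<sigma> p" by (simp add: algebra_simps)
      then show "(\<theta>' (f n p))\<^sup>2 * ((4 * x ^ 3)\<^sup>2 + x\<^sup>2 * (2 * y)\<^sup>2) \<le> 16 * (16 * x\<^sup>2 * \<sigma> p)"
        by (intro mult_mono \<theta>'_bd) auto
      show "(\<sigma> p)\<^sup>2 * 1 * N\<^sup>2 \<le> (\<sigma> p)\<^sup>2 * (ln 16)\<^sup>2 * N\<^sup>2"
        using ln16' by (intro mult_right_mono mult_left_mono) auto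
    qed (use \<sigma>1[of p] N in auto)
    also have "\<dots> = 256 / N\<^sup>2 * (x\<^sup>2 / \<sigma> p)"
      using \<sigma>1[of p] N by (simp add: power2_eq_square field_simps)
    also have "\<dots> \<le> 256 / N\<^sup>2 * (\<Sum>k<2 * Suc n. (fst p)\<^sup>2 * indicator (BG (2 ^ Suc k)) p / 16 ^ k)"
      by (intro mult_left_mono s) simp
    finally show ?thesis by (simp add: N_def)
  qed
  show ?thesis by (rule that[OF 1 2 3 4])
qed

text \<open>By the growth bound at radius \<open>2 ^ Suc k\<close>, each shell contributes at most
  \<open>16 * C\<close> after division by \<open>16 ^ k\<close>. There are \<open>2 * Suc n\<close>
  shells against a prefactor of order \<open>1 / (Suc n)\<^sup>2\<close>, which leaves a bound of
  order \<open>1 / Suc n\<close>; growth of order R^4 is the rate for which a logarithmic cutoff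
  suffices.\<close>

lemma log_cutoff_integral_tendsto_0:
  fixes w :: "real \<times> real \<Rightarrow> real"
  assumes w: "continuous_on UNIV w" "\<And>p. w p \<ge> 0"
    and C: "\<And>R. R > 1 \<Longrightarrow> (LINT p:BG R|lborel. (fst p)\<^sup>2 * w p) \<le> C * R ^ 4"
    and G: "\<And>n. integrable lborel (\<lambda>p. w p * G n p)" "\<And>n p. 0 \<le> G n p"
      "\<And>n p. G n p \<le> 256 / (real (Suc n))\<^sup>2 * (\<Sum>k<2 * Suc n. (fst p)\<^sup>2 * indicator (BG (2 ^ Suc k)) p / 16 ^ k)"
  shows "(\<lambda>n. LINT p|lborel. w p * G n p) \<longlonglongrightarrow> 0"
proof (rule tendsto_sandwich)
  show "\<forall>\<^sub>F n in sequentially. 0 \<le> (LINT p|lborel. w p * G n p)"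
    using w(2) G(2) by simp
  show "\<forall>\<^sub>F n in sequentially. (LINT p|lborel. w p * G n p) \<le> 8192 * C * (1 / real (Suc n))"
  proof (intro always_eventually allI)
    fix n
    define N where "N = real (Suc n)"
    have N: "N > 0" by (simp add: N_def)
    have si: "integrable lborel (\<lambda>p. indicator (BG (2 ^ Suc k)) p *\<^sub>R ((fst p)\<^sup>2 * w p))" for k
      using set_integrable_BG[of "\<lambda>p. (fst p)\<^sup>2 * w p" "2 ^ Suc k"] w(1)
      by (simp add: set_integrable_def continuous_intros del: power_Suc)
    have "(LINT p|lborel. w p * G n p)
       \<le> (LINT p|lborel. 256 / N\<^sup>2 * (\<Sum>k<2 * Suc n. (1 / 16 ^ k) * (indicator (BG (2 ^ Suc k)) p *\<^sub>R ((fst p)\<^sup>2 * w p))))"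
    proof (rule integral_mono[OF G(1)])
      show "integrable lborel (\<lambda>p. 256 / N\<^sup>2 * (\<Sum>k<2 * Suc n. (1 / 16 ^ k) * (indicator (BG (2 ^ Suc k)) p *\<^sub>R ((fst p)\<^sup>2 * w p))))"
        by (intro integrable_mult_right Bochner_Integration.integrable_sum si)
      fix p
      have "w p * G n p \<le> w p * (256 / N\<^sup>2 * (\<Sum>k<2 * Suc n. (fst p)\<^sup>2 * indicator (BG (2 ^ Suc k)) p / 16 ^ k))"
        unfolding N_def by (intro mult_left_mono G w)
      also have "\<dots> = 256 / N\<^sup>2 * (\<Sum>k<2 * Suc n. w p * ((fst p)\<^sup>2 * indicator (BG (2 ^ Suc k)) p / 16 ^ k))"
        by (simp only: sum_distrib_left mult.left_commute)
      also have "(\<Sum>k<2 * Suc n. w p * ((fst p)\<^sup>2 * indicator (BG (2 ^ Suc k)) p / 16 ^ k))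
         = (\<Sum>k<2 * Suc n. (1 / 16 ^ k) * (indicator (BG (2 ^ Suc k)) p *\<^sub>R ((fst p)\<^sup>2 * w p)))"
        by (intro sum.cong refl) simp
      finally show "w p * G n p \<le> 256 / N\<^sup>2 * (\<Sum>k<2 * Suc n. (1 / 16 ^ k) * (indicator (BG (2 ^ Suc k)) p *\<^sub>R ((fst p)\<^sup>2 * w p)))" .
    qed
    also have "\<dots> = 256 / N\<^sup>2 * (\<Sum>k<2 * Suc n. (1 / 16 ^ k) * (LINT p:BG (2 ^ Suc k)|lborel. (fst p)\<^sup>2 * w p))"
      unfolding set_lebesgue_integral_def
      by (simp only: integral_mult_right_zero Bochner_Integration.integral_sum si integrable_mult_right)
    \<comment> \<open>The radius is \<open>2 ^ Suc k\<close> rather than \<open>2 ^ k\<close>, so it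
      exceeds 1 already for \<open>k = 0\<close>; the shift costs the factor 16.\<close>
    also have "\<dots> \<le> 256 / N\<^sup>2 * (\<Sum>k<2 * Suc n. 16 * C)"
    proof (intro mult_left_mono sum_mono)
      fix k
      have "(1 / 16 ^ k) * (LINT p:BG (2 ^ Suc k)|lborel. (fst p)\<^sup>2 * w p) \<le> (1 / 16 ^ k) * (C * (2 ^ Suc k) ^ 4)"
        by (intro mult_left_mono C one_less_power) auto
      also have "((2::real) ^ Suc k) ^ 4 = 16 * 16 ^ k"
        by (simp add: power_mult_distrib power_mult[symmetric] mult.commute[of k] power_mult)
      finally show "(1 / 16 ^ k) * (LINT p:BG (2 ^ Suc k)|lborel. (fst p)\<^sup>2 * w p) \<le> 16 * C" by simp
    qed simp
    also have "\<dots> = 256 / N\<^sup>2 * (2 * N * (16 * C))" by (simp add: N_def)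
    also have "\<dots> = 8192 * C * (1 / N)"
      using N by (simp add: power2_eq_square field_simps)
    finally show "(LINT p|lborel. w p * G n p) \<le> 8192 * C * (1 / real (Suc n))" by (simp add: N_def)
  qed
  show "(\<lambda>n. 8192 * C * (1 / real (Suc n))) \<longlonglongrightarrow> 0"
    using tendsto_mult_left[OF LIMSEQ_inverse_real_of_nat, of "8192 * C"] by (simp add: inverse_eq_divide)
qed simp

section \<open>The linearized system\<close>

lemma C1_has_partials:
  assumes "C1 f"
  shows "has_partials f (dx f) (dy f)"
proof -
  obtain D where D: "\<And>p. (f has_derivative blinfun_apply (D p)) (at p)" "continuous_on UNIV D"
    using assms unfolding C1_def by blast
  have "blinfun_apply (D p) h = fst h * blinfun_apply (D p) (1, 0) + snd h * blinfun_apply (D p) (0, 1)" for p h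
  proof -
    have "h = fst h *\<^sub>R (1, 0) + snd h *\<^sub>R (0, 1)" by (simp add: prod_eq_iff)
    then have "blinfun_apply (D p) h = blinfun_apply (D p) (fst h *\<^sub>R (1, 0) + snd h *\<^sub>R (0, 1))" by simp
    then show ?thesis by (simp only: blinfun.bilinear_simps real_scaleR_def)
  qed
  then have "blinfun_apply (D p) = (\<lambda>h. fst h * blinfun_apply (D p) (1, 0) + snd h * blinfun_apply (D p) (0, 1))" for p
    by blast
  then have "(f has_derivative (\<lambda>h. fst h * blinfun_apply (D p) (1, 0) + snd h * blinfun_apply (D p) (0, 1))) (at p)" for p
    using D(1)[of p] by simp
  moreover have "continuous_on UNIV (\<lambda>p. blinfun_apply (D p) h)" for h
    by (intro continuous_intros D)
  ultimately have "has_partials f (\<lambda>p. D p (1, 0)) (\<lambda>p. D p (0, 1))"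
    unfolding has_partials_def by blast
  with along_has_partials(4,5)[OF this] show ?thesis by simp
qed

lemma C1_bounded_linear:
  assumes "C1 f" "bounded_linear L"
  shows "C1 (\<lambda>x. L (f x))"
proof -
  obtain D where D: "\<And>p. (f has_derivative blinfun_apply (D p)) (at p)" "continuous_on UNIV D"
    using assms unfolding C1_def by blast
  have "((\<lambda>x. L (f x)) has_derivative blinfun_apply (Blinfun L o\<^sub>L D x)) (at x)" for x
    using bounded_linear.has_derivative[OF assms(2) D(1)]
    by (simp add: blinfun_compose.rep_eq comp_def bounded_linear_Blinfun_apply[OF assms(2)])
  moreover have "continuous_on UNIV (\<lambda>x. Blinfun L o\<^sub>L D x)"
    by (intro continuous_intros D)
  ultimately show ?thesis
    unfolding C1_def by (intro exI[of _ "\<lambda>x. Blinfun L o\<^sub>L D x"]) simp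
qed

lemma C1_imp_continuous: "C1 f \<Longrightarrow> continuous_on UNIV f"
  unfolding C1_def by (meson has_derivative_continuous_on has_derivative_at_withinI)

lemma C2_imp_C1: "C2 f \<Longrightarrow> C1 f"
  unfolding C2_def by (metis C1_def C1_imp_continuous)

text \<open>A partial derivative of \<open>L \<circ> f\<close> is a bounded linear image of the
  derivative map \<open>D\<close>, and \<open>D\<close> is C1. With \<open>L\<close> a coordinate
  projection this covers the components of the solution.\<close>

lemma C2_bounded_linear:
  assumes "C2 f" "bounded_linear L"
  shows "C1 (dx (\<lambda>p. L (f p)))" "C1 (dy (\<lambda>p. L (f p)))"
proof -
  obtain D where D: "\<And>p. (f has_derivative blinfun_apply (D p)) (at p)" and CD: "C1 D"
    using assms unfolding C2_def by blast
  have D': "((\<lambda>p. L (f p)) has_derivative (\<lambda>h. L (blinfun_apply (D p) h))) (at p)" for p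
    by (rule bounded_linear.has_derivative[OF assms(2) D])
  have dxy: "dx (\<lambda>p. L (f p)) = (\<lambda>p. L (blinfun_apply (D p) (1, 0)))"
    "dy (\<lambda>p. L (f p)) = (\<lambda>p. L (blinfun_apply (D p) (0, 1)))"
    unfolding dx_def dy_def by (rule ext, rule along_has_derivative[OF D'])+
  have "bounded_linear (\<lambda>B. L (blinfun_apply B h))" for h
    by (rule bounded_linear_compose[OF assms(2)]) (rule blinfun.bounded_linear_left)
  then have "C1 (\<lambda>p. L (blinfun_apply (D p) h))" for h
    by (rule C1_bounded_linear[OF CD])
  then show "C1 (dx (\<lambda>p. L (f p)))" "C1 (dy (\<lambda>p. L (f p)))"
    unfolding dxy by blast+
qed

text \<open>In this form the identities carry their integrability with them: they can be added and
  subtracted, and the resulting integrand is then normalized by pure algebra.\<close>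

lemma has_bochner_integral_partials:
  assumes f: "has_partials f a b" and g: "has_partials g c d" "bdd_support g"
  shows "has_bochner_integral lborel (\<lambda>p. a p * g p + f p * c p) 0"
    and "has_bochner_integral lborel (\<lambda>p. b p * g p + f p * d p) 0"
    and "has_bochner_integral lborel (\<lambda>p. a p * d p - b p * c p) 0"
proof -
  note F = has_partialsD[OF f]
  note cc = cont_bdd_support_mult_left cont_bdd_support_integrable
  note G = cont_bdd_support_partials[OF g]
  have i: "integrable lborel (\<lambda>p. u p * g p)" "integrable lborel (\<lambda>p. u p * c p)" "integrable lborel (\<lambda>p. u p * d p)"
    if "continuous_on UNIV u" for u
    by (intro cc that G)+
  show "has_bochner_integral lborel (\<lambda>p. a p * g p + f p * c p) 0"
    "has_bochner_integral lborel (\<lambda>p. b p * g p + f p * d p) 0"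
    "has_bochner_integral lborel (\<lambda>p. a p * d p - b p * c p) 0"
    using i[OF F(2)] i[OF F(3)] i[OF F(4)] integration_by_parts[OF f g] integral_partials_commute[OF f g]
    by (auto simp: has_bochner_integral_iff)
qed

text \<open>Schwarz's theorem in weak form: tested against \<open>g\<close>, the difference of the
  mixed partials becomes the integral of \<open>b * c - a * d\<close>, which vanishes by
  \<open>integral_partials_commute\<close>. The fundamental lemma makes this pointwise.\<close>

lemma mixed_partials_eq:
  assumes f: "has_partials f a b" and a: "has_partials a axx axy" and b: "has_partials b byx byy"
  shows "axy = byx"
proof
  fix p
  have "axy p - byx p = 0"
  proof (rule integral_mult_eq_0_imp_eq_0)
    show "continuous_on UNIV (\<lambda>p. axy p - byx p)"
      by (intro continuous_intros has_partialsD[OF a] has_partialsD[OF b])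
    fix g c d assume g: "has_partials g c d" "bdd_support g"
    note H = has_bochner_integral_add[OF has_bochner_integral_diff[OF has_bochner_integral_partials(2)[OF a g]
          has_bochner_integral_partials(1)[OF b g]] has_bochner_integral_minus[OF has_bochner_integral_partials(3)[OF f g]]]
    have "has_bochner_integral lborel (\<lambda>p. (axy p - byx p) * g p) 0"
      using H by (simp add: algebra_simps)
    then show "(LINT p|lborel. (axy p - byx p) * g p) = 0"
      by (simp add: has_bochner_integral_iff)
  qed
  then show "axy p = byx p" by simp
qed

section \<open>The nonlinearity along a solution, and the weak linearized equations\<close>

lemma linear_vec_expand:
  fixes L :: "real ^ 'm::finite \<Rightarrow> real"
  assumes "linear L"
  shows "L h = (\<Sum>j\<in>UNIV. h $ j * L (axis j 1))"
proof -
  have "h = (\<Sum>j\<in>UNIV. h $ j *\<^sub>R axis j 1)"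
    using basis_expansion[of h] by (simp add: scalar_mult_eq_scaleR)
  then have "L h = L (\<Sum>j\<in>UNIV. h $ j *\<^sub>R axis j 1)" by simp
  then show ?thesis using assms by (simp add: linear_sum linear_scale)
qed

lemma has_partials_system:
  fixes u :: "real \<times> real \<Rightarrow> real ^ 'm::finite" and H :: "real ^ 'm \<Rightarrow> real"
  assumes H: "C1 H" and u: "C1 u"
    and uj: "\<And>j. has_partials (\<lambda>q. u q $ j) (ux j) (uy j)"
  shows "has_partials (\<lambda>p. H (u p)) (\<lambda>p. \<Sum>j\<in>UNIV. partial j H (u p) * ux j p)
      (\<lambda>p. \<Sum>j\<in>UNIV. partial j H (u p) * uy j p)"
    and "continuous_on UNIV (\<lambda>p. partial j H (u p))"
proof -
  obtain E where E: "\<And>y. (H has_derivative blinfun_apply (E y)) (at y)" and cE: "continuous_on UNIV E"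
    using H unfolding C1_def by blast
  obtain D where D: "\<And>p. (u has_derivative blinfun_apply (D p)) (at p)"
    using u unfolding C1_def by blast
  have par: "partial j H y = E y (axis j 1)" for j y
    unfolding partial_def by (rule along_has_derivative[OF E])
  have cu: "continuous_on UNIV u"
    by (rule C1_imp_continuous[OF u])
  show c: "continuous_on UNIV (\<lambda>p. partial j H (u p))" for j
    unfolding par by (intro continuous_intros continuous_on_compose2[OF cE cu]) auto
  have Dj: "D p h $ j = fst h * ux j p + snd h * uy j p" for p h j
  proof -
    have "((\<lambda>q. u q $ j) has_derivative (\<lambda>h. D p h $ j)) (at p)"
      by (rule bounded_linear.has_derivative[OF bounded_linear_vec_nth D])
    from has_derivative_unique[OF this has_partialsD(1)[OF uj]] show ?thesis by (rule fun_cong)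
  qed
  show "has_partials (\<lambda>p. H (u p)) (\<lambda>p. \<Sum>j\<in>UNIV. partial j H (u p) * ux j p)
      (\<lambda>p. \<Sum>j\<in>UNIV. partial j H (u p) * uy j p)"
    unfolding has_partials_def
  proof (intro conjI allI)
    fix p
    have "((\<lambda>p. H (u p)) has_derivative (\<lambda>h. E (u p) (D p h))) (at p)"
      by (rule has_derivative_compose[OF D E])
    moreover have "E (u p) (D p h) = fst h * (\<Sum>j\<in>UNIV. partial j H (u p) * ux j p)
        + snd h * (\<Sum>j\<in>UNIV. partial j H (u p) * uy j p)" for h
    proof -
      have "E (u p) (D p h) = (\<Sum>j\<in>UNIV. D p h $ j * E (u p) (axis j 1))"
        by (rule linear_vec_expand) (rule bounded_linear.linear[OF blinfun.bounded_linear_right])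
      then show ?thesis
        unfolding Dj par[symmetric] sum_distrib_left sum.distrib[symmetric] by (simp add: algebra_simps)
    qed
    ultimately show "((\<lambda>p. H (u p)) has_derivative (\<lambda>h. fst h * (\<Sum>j\<in>UNIV. partial j H (u p) * ux j p)
        + snd h * (\<Sum>j\<in>UNIV. partial j H (u p) * uy j p))) (at p)"
      by simp
  qed (intro continuous_on_sum continuous_on_mult c has_partialsD(2,3)[OF uj])+
qed

text \<open>Stability as nonnegativity of one integral: the sums of integrals in the hypothesis are
  collected into the energy density, all terms being integrable.\<close>

lemma stable_solution_energy:
  fixes H :: "'m::finite \<Rightarrow> real ^ 'm \<Rightarrow> real"
  assumes "stable_solution H u"
    and hc: "\<And>i j. continuous_on UNIV (\<lambda>p. partial i (H j) (u p))"
    and \<zeta>: "\<And>i. has_partials (\<zeta> i) (a i) (b i)" "\<And>i. bdd_support (\<zeta> i)"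
  shows "0 \<le> (LINT p|lborel. energy_density (\<lambda>i j p. partial i (H j) (u p)) \<zeta> a b p)"
proof -
  have n: "(norm (gradG (\<zeta> i) p))\<^sup>2 = (a i p)\<^sup>2 + (fst p)\<^sup>2 * (b i p)\<^sup>2" for i p
    by (simp add: norm_gradG along_has_partials[OF \<zeta>(1)] power_mult_distrib)
  have i1: "integrable lborel (\<lambda>p. (a i p)\<^sup>2 + (fst p)\<^sup>2 * (b i p)\<^sup>2)" for i
    unfolding power2_eq_square
    by (intro cont_bdd_support_integrable cont_bdd_support_add cont_bdd_support_mult_left continuous_on_mult
      continuous_on_fst continuous_on_id cont_bdd_support_partials[OF \<zeta>]
      has_partialsD(2,3,4)[OF \<zeta>(1)])
  have i2: "integrable lborel (\<lambda>p. partial i (H j) (u p) * \<zeta> i p * \<zeta> j p)" for i j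
    by (intro cont_bdd_support_integrable cont_bdd_support_mult_left continuous_on_mult hc
       cont_bdd_support_partials[OF \<zeta>] has_partialsD(2,3,4)[OF \<zeta>(1)])
  have "- (\<Sum>i\<in>UNIV. \<Sum>j\<in>UNIV. LINT p|lborel. partial i (H j) (u p) * \<zeta> i p * \<zeta> j p)
        \<le> (\<Sum>i\<in>UNIV. LINT p|lborel. (norm (gradG (\<zeta> i) p))\<^sup>2)"
    using assms(1) C1c_has_partials[OF \<zeta>] unfolding stable_solution_def by blast
  then have "0 \<le> (\<Sum>i\<in>UNIV. (LINT p|lborel. (a i p)\<^sup>2 + (fst p)\<^sup>2 * (b i p)\<^sup>2)
       + (\<Sum>j\<in>UNIV. LINT p|lborel. partial i (H j) (u p) * \<zeta> i p * \<zeta> j p))"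
    unfolding n by (simp add: sum.distrib)
  also have "\<dots> = (LINT p|lborel. energy_density (\<lambda>i j p. partial i (H j) (u p)) \<zeta> a b p)"
    unfolding energy_density_def
    by (simp only: Bochner_Integration.integral_sum Bochner_Integration.integral_add
      Bochner_Integration.integrable_sum Bochner_Integration.integrable_add i1 i2)
  finally show ?thesis .
qed

text \<open>Formally this is the x-derivative of the equation, whose weight produces the commutator
  term 2 x uyy. Rigorously, the left side \<open>F\<close> is C1 as a whole and is integrated
  against the x-derivative of \<psi>; exchanging the partials of \<open>uy\<close> and of
  \<open>x\<^sup>2 \<psi>\<close> then turns \<open>x\<^sup>2 uyy a\<close> into
  \<open>x\<^sup>2 uxy b\<close> plus that term.\<close>

lemma linearized_X:
  assumes ux: "has_partials ux uxx uxy" and uy: "has_partials uy uxy uyy"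
    and F: "has_partials (\<lambda>p. uxx p + (fst p)\<^sup>2 * uyy p) Fx Fy"
    and \<psi>: "has_partials \<psi> a b" "bdd_support \<psi>"
  shows "(LINT p|lborel. uxx p * a p + (fst p)\<^sup>2 * uxy p * b p + Fx p * \<psi> p)
    = (LINT p|lborel. 2 * fst p * uyy p * \<psi> p)"
proof -
  have g: "has_partials (\<lambda>p. fst p * fst p * \<psi> p) (\<lambda>p. (fst p + fst p) * \<psi> p + fst p * fst p * a p) (\<lambda>p. fst p * fst p * b p)"
    using has_partials_mult[OF has_partials_mult[OF has_partials_fst has_partials_fst] \<psi>(1)] by simp
  have gs: "bdd_support (\<lambda>p. fst p * fst p * \<psi> p)" by (rule bdd_support_subset[OF \<psi>(2)]) simp
  have "has_bochner_integral lborel (\<lambda>p. (uxx p * a p + (fst p)\<^sup>2 * uxy p * b p + Fx p * \<psi> p)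
      - 2 * fst p * uyy p * \<psi> p) 0"
    using has_bochner_integral_add[OF has_bochner_integral_partials(1)[OF F \<psi>] has_bochner_integral_partials(3)[OF uy g gs]]
    by (simp add: algebra_simps power2_eq_square)
  moreover have "integrable lborel (\<lambda>p. 2 * fst p * uyy p * \<psi> p)"
    by (intro cont_bdd_support_integrable cont_bdd_support_mult_left continuous_on_mult
      continuous_on_const continuous_on_fst continuous_on_id cont_bdd_support_partials[OF \<psi>] has_partialsD[OF uy])
  ultimately show ?thesis
    using has_bochner_integral_add[of lborel _ 0 "\<lambda>p. 2 * fst p * uyy p * \<psi> p"]
    by (fastforce simp: has_bochner_integral_iff)
qed

text \<open>Formally this is x times the y-derivative of the equation. \<open>F\<close> is tested
  with \<open>x \<psi>\<close>, and the partials of \<open>ux\<close> and of \<open>x \<psi>\<close>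
  are exchanged. The commutator term \<open>2 uxy\<close> has two equal sources: the x-derivative of
  the factor x in that exchange, and the integration by parts of \<open>uy\<close> against
  \<psi>.\<close>

lemma linearized_Y:
  assumes ux: "has_partials ux uxx uxy" and uy: "has_partials uy uxy uyy"
    and F: "has_partials (\<lambda>p. uxx p + (fst p)\<^sup>2 * uyy p) Fx Fy"
    and \<psi>: "has_partials \<psi> a b" "bdd_support \<psi>"
  shows "(LINT p|lborel. (uy p + fst p * uxy p) * a p + (fst p)\<^sup>2 * (fst p * uyy p) * b p + Fy p * (fst p * \<psi> p))
    = (LINT p|lborel. - 2 * uxy p * \<psi> p)"
proof -
  have g: "has_partials (\<lambda>p. fst p * \<psi> p) (\<lambda>p. \<psi> p + fst p * a p) (\<lambda>p. fst p * b p)"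
    using has_partials_mult[OF has_partials_fst \<psi>(1)] by simp
  have gs: "bdd_support (\<lambda>p. fst p * \<psi> p)" by (rule bdd_support_subset[OF \<psi>(2)]) simp
  have "has_bochner_integral lborel (\<lambda>p. ((uy p + fst p * uxy p) * a p + (fst p)\<^sup>2 * (fst p * uyy p) * b p + Fy p * (fst p * \<psi> p))
      - (- 2 * uxy p * \<psi> p)) 0"
    using has_bochner_integral_add[OF has_bochner_integral_diff[OF has_bochner_integral_partials(2)[OF F g gs]
       has_bochner_integral_partials(3)[OF ux g gs]] has_bochner_integral_partials(1)[OF uy \<psi>]]
    by (simp add: algebra_simps power2_eq_square)
  moreover have "integrable lborel (\<lambda>p. - 2 * uxy p * \<psi> p)"
    by (intro cont_bdd_support_integrable cont_bdd_support_mult_left continuous_on_mult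
      continuous_on_const continuous_on_fst continuous_on_id cont_bdd_support_partials[OF \<psi>] has_partialsD[OF uy])
  ultimately show ?thesis
    using has_bochner_integral_add[of lborel _ 0 "\<lambda>p. - 2 * uxy p * \<psi> p"]
    by (fastforce simp: has_bochner_integral_iff)
qed

section \<open>Rigidity from vanishing derivatives and from growth\<close>

lemma has_partials_0_imp_const:
  assumes "has_partials f (\<lambda>_. 0) (\<lambda>_. 0)"
  obtains c where "\<And>p. f p = c"
proof -
  have "(f has_derivative (\<lambda>_. 0)) (at p within UNIV)" for p
    using has_partialsD(1)[OF assms, of p] by simp
  then have "\<exists>c. \<forall>p\<in>UNIV. f p = c"
    by (intro has_derivative_zero_constant) auto
  then show ?thesis using that by auto
qed

lemma has_partials_dy_0_imp:
  assumes "has_partials f a (\<lambda>_. 0)"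
  shows "f (x, y) = f (x, 0)"
proof -
  have g: "((\<lambda>t. (x, t)) has_derivative (\<lambda>t. (0, t))) (at t)" for t
    by (auto intro!: derivative_eq_intros)
  have "((\<lambda>t. f (x, t)) has_derivative (\<lambda>_. 0)) (at t within UNIV)" for t
    using has_derivative_compose[OF g has_partialsD(1)[OF assms]] by simp
  then have "\<exists>c. \<forall>t\<in>UNIV. f (x, t) = c"
    by (intro has_derivative_zero_constant) auto
  then show ?thesis by auto
qed

text \<open>The field Y degenerates on the axis x = 0, where an identity multiplied by x says
  nothing. Points of the axis are reached as limits from x > 0.\<close>

lemma continuous_eq_0_off_axis:
  fixes f :: "real \<times> real \<Rightarrow> real"
  assumes f: "continuous_on UNIV f" and z: "\<And>p. fst p * f p = 0"
  shows "f p = 0"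
proof (cases "fst p = 0")
  case True
  have "isCont f p" using f by (metis UNIV_I continuous_on_eq_continuous_within)
  moreover have "(\<lambda>n. (inverse (real (Suc n)), snd p)) \<longlonglongrightarrow> (0, snd p)"
    by (intro tendsto_Pair tendsto_const LIMSEQ_inverse_real_of_nat)
  then have "(\<lambda>n. (inverse (real (Suc n)), snd p)) \<longlonglongrightarrow> p"
    using True by (metis prod.collapse)
  ultimately have "(\<lambda>n. f (inverse (real (Suc n)), snd p)) \<longlonglongrightarrow> f p"
    by (rule isCont_tendsto_compose)
  moreover have "f (inverse (real (Suc n)), snd p) = 0" for n
    using z[of "(inverse (real (Suc n)), snd p)"] by simp
  ultimately show ?thesis by (simp add: LIMSEQ_const_iff)
qed (use z[of p] in simp)

text \<open>A nonzero \<open>b\<close> would make the weighted integral grow at least like R^7: a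
  box of area R^3/8 inside \<open>BG R\<close> lies where x is at least R/4, and the integrand there
  is at least \<open>x\<^sup>4 b\<^sup>2\<close>. This contradicts a bound of order R^4.\<close>

lemma growth_imp_eq_0:
  fixes f :: "real \<times> real \<Rightarrow> real"
  assumes f: "continuous_on UNIV f" "\<And>p. f p \<ge> (fst p * b)\<^sup>2"
    and C: "\<And>R. R > 1 \<Longrightarrow> (LINT p:BG R|lborel. (fst p)\<^sup>2 * f p) \<le> C * R ^ 4"
  shows "b = 0"
proof (rule ccontr)
  assume b: "b \<noteq> 0"
  \<comment> \<open>The constant is 4^4 * 8, from (R/4)^4 and the area R^3/8. The surviving power
    R^3 is weakened to R, which is already contradictory for large R.\<close>
  have *: "b\<^sup>2 * R \<le> 2048 * \<bar>C\<bar>" if R: "R > 1" for R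
  proof -
    define S where "S = cbox (R / 4, 0) (R / 2, R\<^sup>2 / 2)"
    have S_BG: "S \<subseteq> BG R"
    proof
      fix p assume "p \<in> S"
      then have p: "R / 4 \<le> fst p" "fst p \<le> R / 2" "0 \<le> snd p" "snd p \<le> R\<^sup>2 / 2"
        by (auto simp: S_def cbox_Pair_eq mem_Times_iff)
      have "fst p ^ 4 \<le> (R / 2) ^ 4" using p R by (intro power_mono) auto
      moreover have "(snd p)\<^sup>2 \<le> (R\<^sup>2 / 2)\<^sup>2" using p by (intro power_mono) auto
      moreover have "(R / 2) ^ 4 + (R\<^sup>2 / 2)\<^sup>2 < R ^ 4"
        using R by (simp add: power_divide power_mult[symmetric])
      ultimately show "p \<in> BG R" by (cases p) (auto simp: BG_def)
    qed
    have mS: "measure lborel S = R ^ 3 / 8"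
      unfolding S_def content_Pair using R by (simp add: power2_eq_square power3_eq_cube)
    have iS: "integrable lborel (indicator S :: real \<times> real \<Rightarrow> real)"
      unfolding S_def by (rule integrable_real_indicator) (simp, rule emeasure_lborel_cbox_finite)
    have "(R / 4) ^ 4 * b\<^sup>2 * (R ^ 3 / 8) = (LINT p|lborel. indicator S p * ((R / 4) ^ 4 * b\<^sup>2))"
      using mS by (simp only: integral_mult_left_zero) (simp add: S_def mult.commute)
    also have "\<dots> \<le> (LINT p|lborel. indicator (BG R) p *\<^sub>R ((fst p)\<^sup>2 * f p))"
    proof (rule integral_mono)
      show "integrable lborel (\<lambda>p. indicator S p * ((R / 4) ^ 4 * b\<^sup>2))"
        by (intro integrable_mult_left iS)
      show "integrable lborel (\<lambda>p. indicator (BG R) p *\<^sub>R ((fst p)\<^sup>2 * f p))"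
        using set_integrable_BG[of "\<lambda>p. (fst p)\<^sup>2 * f p" R] f(1) R
        by (simp add: set_integrable_def continuous_intros)
      fix p
      have nn: "0 \<le> (fst p)\<^sup>2 * f p" using f(2)[of p] by (meson mult_nonneg_nonneg order_trans zero_le_power2)
      show "indicator S p * ((R / 4) ^ 4 * b\<^sup>2) \<le> indicator (BG R) p *\<^sub>R ((fst p)\<^sup>2 * f p)"
      proof (cases "p \<in> S")
        case True
        then have p: "R / 4 \<le> fst p" by (auto simp: S_def cbox_Pair_eq mem_Times_iff)
        have "(R / 4) ^ 4 * b\<^sup>2 \<le> fst p ^ 4 * b\<^sup>2"
          using p R by (intro mult_right_mono power_mono) auto
        also have "\<dots> = (fst p)\<^sup>2 * (fst p * b)\<^sup>2"
          by (simp add: power_mult_distrib power4_eq_xxxx power2_eq_square mult.assoc)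
        also have "\<dots> \<le> (fst p)\<^sup>2 * f p" by (intro mult_left_mono f) auto
        finally show ?thesis using True S_BG by (auto simp: indicator_def)
      qed (use nn in \<open>auto simp: indicator_def\<close>)
    qed
    also have "\<dots> \<le> C * R ^ 4" using C[OF R] by (simp add: set_lebesgue_integral_def)
    also have "\<dots> \<le> \<bar>C\<bar> * R ^ 4" by (intro mult_right_mono) auto
    finally have "b\<^sup>2 * R ^ 7 \<le> 2048 * \<bar>C\<bar> * R ^ 4"
      by (simp add: power_divide field_simps)
    moreover have "R ^ 7 = R ^ 3 * R ^ 4" by (simp flip: power_add)
    ultimately have "(b\<^sup>2 * R ^ 3) * R ^ 4 \<le> (2048 * \<bar>C\<bar>) * R ^ 4"
      by (simp only: mult.assoc)
    then have "b\<^sup>2 * R ^ 3 \<le> 2048 * \<bar>C\<bar>" using R by (subst (asm) mult_le_cancel_right) auto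
    moreover have "b\<^sup>2 * R ^ 1 \<le> b\<^sup>2 * R ^ 3"
      using R by (intro mult_left_mono power_increasing) auto
    ultimately show ?thesis by simp
  qed
  \<comment> \<open>The summand 2 ensures \<open>R > 1\<close> and makes
    \<open>b\<^sup>2 * R\<close> exceed the bound by \<open>2 * b\<^sup>2\<close>.\<close>
  define R where "R = 2048 * \<bar>C\<bar> / b\<^sup>2 + 2"
  have "0 \<le> 2048 * \<bar>C\<bar> / b\<^sup>2" by simp
  then have "R > 1" unfolding R_def by linarith
  have "b\<^sup>2 * R = 2048 * \<bar>C\<bar> + 2 * b\<^sup>2"
    unfolding R_def distrib_left using b by simp
  moreover have "b\<^sup>2 > 0" using b by simp
  ultimately show False using *[OF \<open>R > 1\<close>] by linarith
qed

theorem theorem4p4: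
  fixes H :: "'m::finite \<Rightarrow> real ^ 'm \<Rightarrow> real"
    and u :: "real \<times> real \<Rightarrow> real ^ 'm"
  assumes "\<And>i. C1 (H i)"
    and "C2 u"
    and "symmetric_system H u"
    and "stable_solution H u"
    and "\<And>i p. Z (Y (\<lambda>q. u q $ i)) p * X (\<lambda>q. u q $ i) p
              - Z (X (\<lambda>q. u q $ i)) p * Y (\<lambda>q. u q $ i) p \<le> 0"
    and "\<And>i p. norm (gradG (\<lambda>q. u q $ i) p) \<noteq> 0"
    and "\<And>i. \<exists>C. \<forall>R>1.
           (LINT p:BG R|lborel. (fst p)\<^sup>2 * (norm (gradG (\<lambda>q. u q $ i) p))\<^sup>2) \<le> C * R ^ 4"
  shows "\<forall>i. \<exists>g. \<forall>x y. u (x, y) $ i = g x"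
proof -
  define ux where "ux i = dx (\<lambda>q. u q $ i)" for i
  define uy where "uy i = dy (\<lambda>q. u q $ i)" for i
  define uxx where "uxx i = dx (ux i)" for i
  define uxy where "uxy i = dy (ux i)" for i
  define uyy where "uyy i = dy (uy i)" for i
  define h where "h i j p = partial i (H j) (u p)" for i j p
  have C1u: "C1 u" using assms(2) by (rule C2_imp_C1)
  have Pu: "has_partials (\<lambda>q. u q $ i) (ux i) (uy i)" for i
    unfolding ux_def uy_def by (rule C1_has_partials[OF C1_bounded_linear[OF C1u bounded_linear_vec_nth]])
  have Px: "has_partials (ux i) (uxx i) (uxy i)" for i
    unfolding ux_def uxx_def uxy_def
    by (rule C1_has_partials[OF C2_bounded_linear(1)[OF assms(2) bounded_linear_vec_nth]])
  have Py': "has_partials (uy i) (dx (uy i)) (uyy i)" for i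
    unfolding uy_def uyy_def
    by (rule C1_has_partials[OF C2_bounded_linear(2)[OF assms(2) bounded_linear_vec_nth]])
  \<comment> \<open>From here on a single function \<open>uxy\<close> serves as both mixed
    partials.\<close>
  have Py: "has_partials (uy i) (uxy i) (uyy i)" for i
    using Py'[of i] mixed_partials_eq[OF Pu Px Py', of i] by simp
  have PY: "has_partials (\<lambda>p. fst p * uy i p) (\<lambda>p. uy i p + fst p * uxy i p) (\<lambda>p. fst p * uyy i p)" for i
    using has_partials_mult[OF has_partials_fst Py[of i]] by simp
  have XYZ: "X (\<lambda>q. u q $ i) = ux i" "Y (\<lambda>q. u q $ i) = (\<lambda>p. fst p * uy i p)"
    "Z (ux i) = uxy i" "Z (\<lambda>p. fst p * uy i p) = (\<lambda>p. fst p * uyy i p)" for i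
    using along_has_partials[OF Pu] along_has_partials(3)[OF Px] along_has_partials(3)[OF PY] by simp_all
  have sgn: "fst p * uyy i p * ux i p - uxy i p * (fst p * uy i p) \<le> 0" for i p
    using assms(5)[where i = i and p = p] unfolding XYZ .
  have sym: "h i j p = h j i p" for i j p
    using assms(3) unfolding symmetric_system_def Let_def h_def
    by (metis (no_types, lifting) transpose_def vec_lambda_beta)
  have hc: "continuous_on UNIV (h i j)" for i j
    unfolding h_def by (rule has_partials_system(2)[OF assms(1) C1u Pu])
  \<comment> \<open>The second derivatives are only known to be continuous, but this combination of
    them is a C1 function of \<open>u\<close> and can be differentiated. The chain rule yields the
    entries \<open>h j i\<close>; symmetry turns them into the \<open>h i j\<close> of the stability
    form.\<close>
  have "uxx i p + (fst p)\<^sup>2 * uyy i p = H i (u p)" for i p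
    using assms(4) unfolding stable_solution_def solution_def uxx_def uyy_def ux_def uy_def
    by (cases p) simp
  then have F: "has_partials (\<lambda>p. uxx i p + (fst p)\<^sup>2 * uyy i p)
      (\<lambda>p. \<Sum>j\<in>UNIV. h i j p * ux j p) (\<lambda>p. \<Sum>j\<in>UNIV. h i j p * uy j p)" for i
    using has_partials_system(1)[OF assms(1)[of i] C1u Pu] unfolding sym[of i] by (simp add: h_def)
  have stable: "0 \<le> (LINT p|lborel. energy_density h \<zeta> a b p)"
    if "\<And>i. has_partials (\<zeta> i) (a i) (b i)" "\<And>i. bdd_support (\<zeta> i)" for \<zeta> a b
    using stable_solution_energy[OF assms(4) hc[unfolded h_def] that] unfolding h_def .
  have weakX: "(LINT p|lborel. uxx i p * a p + (fst p)\<^sup>2 * uxy i p * b p + (\<Sum>j\<in>UNIV. h i j p * ux j p) * \<psi> p)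
      = (LINT p|lborel. 2 * fst p * uyy i p * \<psi> p)"
    if "has_partials \<psi> a b" "bdd_support \<psi>" for i \<psi> a b
    by (rule linearized_X[OF Px Py F that])
  have weakY: "(LINT p|lborel. (uy i p + fst p * uxy i p) * a p + (fst p)\<^sup>2 * (fst p * uyy i p) * b p
        + (\<Sum>j\<in>UNIV. h i j p * (fst p * uy j p)) * \<psi> p)
      = (LINT p|lborel. - 2 * uxy i p * \<psi> p)"
    if "has_partials \<psi> a b" "bdd_support \<psi>" for i \<psi> a b
    using linearized_Y[OF Px Py F that, of i]
    by (simp add: sum_distrib_left sum_distrib_right mult_ac)
  obtain \<phi> \<phi>x \<phi>y where \<phi>: "\<And>n. has_partials (\<phi> n) (\<phi>x n) (\<phi>y n)" "\<And>n. bdd_support (\<phi> n)"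
    and flat: "\<And>r. \<forall>\<^sub>F n in sequentially. \<forall>p\<in>cball 0 r. \<phi> n p = 1 \<and> \<phi>x n p = 0 \<and> \<phi>y n p = 0"
    and small: "\<And>n p. (\<phi>x n p)\<^sup>2 + (fst p)\<^sup>2 * (\<phi>y n p)\<^sup>2
      \<le> 256 / (real (Suc n))\<^sup>2 * (\<Sum>k<2 * Suc n. (fst p)\<^sup>2 * indicator (BG (2 ^ Suc k)) p / 16 ^ k)"
    by (rule grushin_log_cutoffs) blast
  \<comment> \<open>The squared Grushin gradient of the cutoff; \<open>w\<close> below is that of
    the solution component, so \<open>S\<close> is the remainder after truncating both
    families.\<close>
  define G where "G n p = (\<phi>x n p)\<^sup>2 + (fst p)\<^sup>2 * (\<phi>y n p)\<^sup>2" for n p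
  define w where "w i p = (ux i p)\<^sup>2 + (fst p * uy i p)\<^sup>2" for i p
  have w: "(norm (gradG (\<lambda>q. u q $ i) p))\<^sup>2 = w i p" for i p
    by (simp add: norm_gradG XYZ w_def)
  have cw: "continuous_on UNIV (w i)" for i
    unfolding w_def by (intro continuous_intros has_partialsD(4)[OF Px] has_partialsD(4)[OF Py])
  have growth: "\<exists>C. \<forall>R>1. (LINT p:BG R|lborel. (fst p)\<^sup>2 * w i p) \<le> C * R ^ 4" for i
    using assms(7)[of i] unfolding w .
  have cG: "cont_bdd_support (G n)" for n
    unfolding G_def power2_eq_square
    by (intro cont_bdd_support_add cont_bdd_support_mult_left continuous_on_mult
      continuous_on_fst continuous_on_id cont_bdd_support_partials[OF \<phi>] has_partialsD(2,3)[OF \<phi>(1)])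
  have iG: "integrable lborel (\<lambda>p. v p * G n p)" if "continuous_on UNIV v" for v n
    by (intro cont_bdd_support_integrable cont_bdd_support_mult_left cG that)
  define S where "S n = (\<Sum>i\<in>UNIV. LINT p|lborel. w i p * G n p)" for n
  have "(\<lambda>n. LINT p|lborel. w i p * G n p) \<longlonglongrightarrow> 0" for i
  proof -
    obtain C where C: "\<And>R. R > 1 \<Longrightarrow> (LINT p:BG R|lborel. (fst p)\<^sup>2 * w i p) \<le> C * R ^ 4"
      using growth by blast
    show ?thesis
      by (rule log_cutoff_integral_tendsto_0[OF cw _ C iG[OF cw] _ small[folded G_def]])
        (auto simp: w_def G_def)
  qed
  then have S0: "S \<longlonglongrightarrow> 0"
    unfolding S_def using tendsto_sum[of UNIV "\<lambda>i n. LINT p|lborel. w i p * G n p" "\<lambda>_. 0" sequentially] by simp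
  define eX where "eX n = (LINT p|lborel. energy_density h (\<lambda>i p. \<phi> n p * ux i p)
      (\<lambda>i p. \<phi>x n p * ux i p + \<phi> n p * uxx i p) (\<lambda>i p. \<phi>y n p * ux i p + \<phi> n p * uxy i p) p)" for n
  define eY where "eY n = (LINT p|lborel. energy_density h (\<lambda>i p. \<phi> n p * (fst p * uy i p))
      (\<lambda>i p. \<phi>x n p * (fst p * uy i p) + \<phi> n p * (uy i p + fst p * uxy i p))
      (\<lambda>i p. \<phi>y n p * (fst p * uy i p) + \<phi> n p * (fst p * uyy i p)) p)" for n
  have kX: "continuous_on UNIV (\<lambda>p. 2 * fst p * uyy i p)" for i
    by (intro continuous_intros has_partialsD(3)[OF Py])
  have kY: "continuous_on UNIV (\<lambda>p. - 2 * uxy i p)" for i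
    by (intro continuous_intros has_partialsD(3)[OF Px])
  have nn: "0 \<le> eX n" "0 \<le> eY n" for n
    unfolding eX_def eY_def
    by (intro stable has_partials_mult \<phi> Px PY; rule bdd_support_subset[OF \<phi>(2)[of n]]; simp)+
  \<comment> \<open>Neither energy alone has a residual of known sign; only their sum meets the sign
    condition on the commutators.\<close>
  have le: "eX n + eY n \<le> S n" for n
  proof -
    define A where "A i p = 2 * fst p * uyy i p * ((\<phi> n p)\<^sup>2 * ux i p)" for i p
    define B where "B i p = - 2 * uxy i p * ((\<phi> n p)\<^sup>2 * (fst p * uy i p))" for i p
    have eXn: "eX n = (\<Sum>i\<in>UNIV. LINT p|lborel. A i p) + (\<Sum>i\<in>UNIV. LINT p|lborel. (ux i p)\<^sup>2 * G n p)"
      unfolding eX_def A_def G_def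
      by (rule integral_energy_density_cutoff[OF hc Px kX weakX \<phi>])
    have eYn: "eY n = (\<Sum>i\<in>UNIV. LINT p|lborel. B i p) + (\<Sum>i\<in>UNIV. LINT p|lborel. (fst p * uy i p)\<^sup>2 * G n p)"
      unfolding eY_def B_def G_def
      by (rule integral_energy_density_cutoff[OF hc PY kY weakY \<phi>])
    have iA: "integrable lborel (A i)" and iB: "integrable lborel (B i)" for i
      unfolding A_def B_def power2_eq_square
      by (intro cont_bdd_support_integrable cont_bdd_support_mult_left cont_bdd_support_mult_right
          kX kY continuous_on_mult continuous_on_fst continuous_on_id
          cont_bdd_support_partials[OF \<phi>] has_partialsD(4)[OF \<phi>(1)] has_partialsD(4)[OF Px] has_partialsD(4)[OF Py])+
    have AB: "(LINT p|lborel. A i p) + (LINT p|lborel. B i p) \<le> 0" for i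
    proof -
      have "0 \<le> - (A i p + B i p)" for p
      proof -
        \<comment> \<open>The two residual terms combine to \<open>2 \<phi>\<^sup>2\<close> times
          the expression assumed nonpositive.\<close>
        have "A i p + B i p = 2 * (\<phi> n p)\<^sup>2 * (fst p * uyy i p * ux i p - uxy i p * (fst p * uy i p))"
          by (simp add: A_def B_def algebra_simps)
        also have "\<dots> \<le> 0" using sgn[of p i] by (intro mult_nonneg_nonpos) auto
        finally show ?thesis by simp
      qed
      then have "0 \<le> (LINT p|lborel. - (A i p + B i p))"
        by (rule Bochner_Integration.integral_nonneg)
      also have "\<dots> = - ((LINT p|lborel. A i p) + (LINT p|lborel. B i p))"
        using iA iB by simp
      finally show ?thesis by simp
    qed
    have W: "(LINT p|lborel. (ux i p)\<^sup>2 * G n p) + (LINT p|lborel. (fst p * uy i p)\<^sup>2 * G n p)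
        = (LINT p|lborel. w i p * G n p)" for i
    proof -
      have "continuous_on UNIV (\<lambda>p. (ux i p)\<^sup>2)" "continuous_on UNIV (\<lambda>p. (fst p * uy i p)\<^sup>2)"
        by (intro continuous_intros has_partialsD(4)[OF Px] has_partialsD(4)[OF Py])+
      then show ?thesis
        unfolding w_def distrib_right by (simp only: Bochner_Integration.integral_add iG)
    qed
    have "eX n + eY n = (\<Sum>i\<in>UNIV. ((LINT p|lborel. A i p) + (LINT p|lborel. B i p)) + (LINT p|lborel. w i p * G n p))"
      unfolding eXn eYn W[symmetric] by (simp add: sum.distrib)
    also have "\<dots> \<le> (\<Sum>i\<in>UNIV. LINT p|lborel. w i p * G n p)"
      by (intro sum_mono add_decreasing AB order_refl)
    finally show ?thesis by (simp add: S_def)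
  qed
  \<comment> \<open>Since each energy is nonnegative, the bound on the sum controls both, and both
    tend to 0.\<close>
  have "eX n \<le> S n" "eY n \<le> S n" for n using nn[of n] le[of n] by linarith+
  then have lim: "eX \<longlonglongrightarrow> 0" "eY \<longlonglongrightarrow> 0"
    by (auto intro!: tendsto_sandwich[OF _ _ tendsto_const S0] simp: nn)
  \<comment> \<open>Along these truncations the form degenerates, so the weak residuals, which are
    the commutator terms, vanish identically.\<close>
  have X0: "2 * fst p * uyy i p = 0" for i p
    by (rule weak_residual_eq_0[OF hc sym stable Px kX weakX \<phi> flat lim(1)[unfolded eX_def]])
  have Y0: "- 2 * uxy i p = 0" for i p
    by (rule weak_residual_eq_0[OF hc sym stable PY kY weakY \<phi> flat lim(2)[unfolded eY_def]])
  have uyy0: "uyy i p = 0" for i p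
    by (rule continuous_eq_0_off_axis[OF has_partialsD(3)[OF Py]]) (use X0 in simp)
  show ?thesis
  proof
    fix i
    have "has_partials (uy i) (\<lambda>_. 0) (\<lambda>_. 0)"
      using Py[of i] Y0 uyy0 by (simp add: has_partials_def)
    then obtain b where b: "\<And>p. uy i p = b" by (rule has_partials_0_imp_const) blast
    obtain C where C: "\<And>R. R > 1 \<Longrightarrow> (LINT p:BG R|lborel. (fst p)\<^sup>2 * w i p) \<le> C * R ^ 4"
      using growth by blast
    \<comment> \<open>The vertical part alone gives \<open>w i p \<ge> (fst p * b)\<^sup>2\<close>,
      to which the growth bound applies.\<close>
    have "b = 0"
      by (rule growth_imp_eq_0[OF cw _ C]) (auto simp: w_def b)
    then have "uy i = (\<lambda>_. 0)" using b by (simp add: fun_eq_iff)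
    with Pu[of i] have "has_partials (\<lambda>q. u q $ i) (ux i) (\<lambda>_. 0)" by (simp only:)
    from has_partials_dy_0_imp[OF this]
    show "\<exists>g. \<forall>x y. u (x, y) $ i = g x" by (intro exI[of _ "\<lambda>x. u (x, 0) $ i"]) blast
  qed
qed

end
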